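(* Let $\sigma$ be a labeled rooted forest on $[n]$ consisting of $r$ copies of the same rooted tree $\tau$. Then the character of $o(\sigma)$ is the plethysm $$\chi^{o(\sigma)}=\chi^{(r)}\circ\chi^{o(\tau)},$$ where $\chi^{(r)}$ is the trivial character of $S_r$.
   Context: $[n]=\{1,\dots,n\}$. The symmetric group $S_n$ acts on labeled rooted forests with vertex set $[n]$ by permuting labels. For such a forest $\sigma$, $o(\sigma)$ is the permutation representation of $S_n$ on the orbit $S_n\cdot\sigma$, with character $\chi^{o(\sigma)}$; it depends only on the underlying unlabeled rooted forest. "Copies of the same rooted tree" means that the connected components are isomorphic as unlabeled rooted trees. The plethysm of characters $\chi\circ\psi$ is defined through the Frobenius characteristic isomorphism $\mathrm{ch}$ onto symmetric functions: $\mathrm{ch}(\chi\circ\psi)=\mathrm{ch}(\chi)\circ\mathrm{ch}(\psi)$, where $g\circ h$ is the plethysm of symmetric functions (so $p_m\circ p_n=p_{mn}$, $g\mapsto p_m\circ g$ is an algebra homomorphism, and $h\mapsto h\circ g$ is an algebra homomorphism). *)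

theory Defs
  imports
    Complex_Main
    "HOL-Library.Multiset"
    "HOL-Library.FuncSet"
    "HOL-Combinatorics.Orbits"
    "HOL-Algebra.Sym_Groups"
    "HOL-Algebra.Group_Action"
begin

section \<open>Symmetric functions\<close>

text \<open>
  The ring \<open>\<Lambda>\<close> of symmetric functions in the variables \<open>x\<^sub>0, x\<^sub>1, x\<^sub>2, \<dots>\<close>: formal power series of
  bounded degree that are invariant under all permutations of the variables.  A monomial is the
  multiset of the indices of its variables (with multiplicity), and a series is the function
  mapping each monomial to its coefficient.
\<close>

definition symmetric_series :: "(nat multiset \<Rightarrow> 'a::zero) \<Rightarrow> bool" where
  "symmetric_series f \<longleftrightarrow>
     (\<exists>d. \<forall>M. f M \<noteq> 0 \<longrightarrow> size M \<le> d) \<and>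
     (\<forall>\<pi> M. bij \<pi> \<longrightarrow> f (image_mset \<pi> M) = f M)"

typedef (overloaded) 'a symfun = "{f :: nat multiset \<Rightarrow> 'a::comm_ring_1. symmetric_series f}"
  morphisms coeff_sf Abs_symfun
  by (rule exI[of _ "\<lambda>_. 0"]) (simp add: symmetric_series_def)

setup_lifting type_definition_symfun

lemma finite_mset_sum_eq: "finite {(A, B). A + B = (M :: 'b multiset)}"
proof (rule finite_subset)
  let ?S = "{A. A \<subseteq># M}"
  show "{(A, B). A + B = M} \<subseteq> ?S \<times> ?S"
    by auto
  have "?S \<subseteq> mset ` {xs. set xs \<subseteq> set_mset M \<and> length xs \<le> size M}"
  proof
    fix A assume "A \<in> ?S"
    moreover obtain xs where "mset xs = A"
      using ex_mset by blast
    ultimately show "A \<in> mset ` {xs. set xs \<subseteq> set_mset M \<and> length xs \<le> size M}"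
      by (metis (mono_tags, lifting) image_eqI mem_Collect_eq set_mset_mono set_mset_mset
          size_mset size_mset_mono)
  qed
  moreover have "finite {xs. set xs \<subseteq> set_mset M \<and> length xs \<le> size M}"
    by (rule finite_lists_length_le) simp
  ultimately have "finite ?S"
    by (meson finite_imageI finite_subset)
  then show "finite (?S \<times> ?S)"
    by simp
qed

lemma image_mset_inv_bij:
  assumes "bij \<pi>"
  shows "image_mset (inv' \<pi>) (image_mset \<pi> M) = M" "image_mset \<pi> (image_mset (inv' \<pi>) M) = M"
  using assms by (simp_all add: multiset.map_comp bij_is_inj bij_is_surj surj_iff[THEN iffD1])

instantiation symfun :: (comm_ring_1) comm_ring_1
begin

lift_definition zero_symfun :: "'a symfun" is "\<lambda>_. 0"
  by (simp add: symmetric_series_def)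

lift_definition one_symfun :: "'a symfun" is "\<lambda>M. if M = {#} then 1 else 0"
  by (auto simp: symmetric_series_def intro!: exI[of _ 0])

lift_definition plus_symfun :: "'a symfun \<Rightarrow> 'a symfun \<Rightarrow> 'a symfun" is "\<lambda>f g M. f M + g M"
proof -
  fix f g :: "nat multiset \<Rightarrow> 'a"
  assume *: "symmetric_series f" "symmetric_series g"
  then obtain d e where "\<And>M. f M \<noteq> 0 \<Longrightarrow> size M \<le> d" "\<And>M. g M \<noteq> 0 \<Longrightarrow> size M \<le> e"
    by (auto simp: symmetric_series_def)
  then have "\<forall>M. f M + g M \<noteq> 0 \<longrightarrow> size M \<le> max d e"
    by (metis add.right_neutral max.coboundedI1 max.coboundedI2)
  with * show "symmetric_series (\<lambda>M. f M + g M)"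
    unfolding symmetric_series_def by auto
qed

lift_definition uminus_symfun :: "'a symfun \<Rightarrow> 'a symfun" is "\<lambda>f M. - f M"
  by (simp add: symmetric_series_def)

definition minus_symfun :: "'a symfun \<Rightarrow> 'a symfun \<Rightarrow> 'a symfun" where
  "minus_symfun f g = f + - g"

lift_definition times_symfun :: "'a symfun \<Rightarrow> 'a symfun \<Rightarrow> 'a symfun"
  is "\<lambda>f g M. \<Sum>(A, B) | A + B = M. f A * g B"
proof -
  fix f g :: "nat multiset \<Rightarrow> 'a"
  assume *: "symmetric_series f" "symmetric_series g"
  then obtain d e where de: "\<And>M. f M \<noteq> 0 \<Longrightarrow> size M \<le> d" "\<And>M. g M \<noteq> 0 \<Longrightarrow> size M \<le> e"
    by (auto simp: symmetric_series_def)
  have sym: "(\<Sum>(A, B) | A + B = image_mset \<pi> M. f A * g B) = (\<Sum>(A, B) | A + B = M. f A * g B)"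
    if \<pi>: "bij \<pi>" for \<pi> M
  proof -
    note inv = image_mset_inv_bij[OF \<pi>]
    show ?thesis
    proof (rule sum.reindex_bij_witness[of _ "map_prod (image_mset \<pi>) (image_mset \<pi>)"
          "map_prod (image_mset (inv' \<pi>)) (image_mset (inv' \<pi>))"])
      fix a assume "a \<in> {(A, B). A + B = image_mset \<pi> M}"
      then show "map_prod (image_mset (inv' \<pi>)) (image_mset (inv' \<pi>)) a \<in> {(A, B). A + B = M}"
        by (auto simp: inv simp flip: image_mset_union)
    next
      fix a assume "a \<in> {(A, B). A + B = image_mset \<pi> M}"
      then show "(case map_prod (image_mset (inv' \<pi>)) (image_mset (inv' \<pi>)) a of
                   (A, B) \<Rightarrow> f A * g B) = (case a of (A, B) \<Rightarrow> f A * g B)"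
        using * bij_imp_bij_inv[OF \<pi>] by (auto simp: symmetric_series_def)
    qed (auto simp: inv)
  qed
  have "\<forall>M. (\<Sum>(A, B) | A + B = M. f A * g B) \<noteq> 0 \<longrightarrow> size M \<le> d + e"
  proof safe
    fix M assume "(\<Sum>(A, B) | A + B = M. f A * g B) \<noteq> 0"
    then obtain A B where "A + B = M" "f A * g B \<noteq> 0"
      by (smt (verit) case_prodE mem_Collect_eq sum.not_neutral_contains_not_neutral case_prod_conv)
    then show "size M \<le> d + e"
      using de(1)[of A] de(2)[of B] by (metis add_mono mult_not_zero size_union)
  qed
  with sym show "symmetric_series (\<lambda>M. \<Sum>(A, B) | A + B = M. f A * g B)"
    unfolding symmetric_series_def by blast
qed

instance
proof
  fix f g h :: "'a symfun"
  show "f + g + h = f + (g + h)"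
    by transfer (simp add: add.assoc)
  show "f + g = g + f"
    by transfer (simp add: add.commute)
  show "0 + f = f"
    by transfer simp
  show "- f + f = 0"
    by transfer simp
  show "f - g = f + - g"
    by (rule minus_symfun_def)
  show "(0 :: 'a symfun) \<noteq> 1"
    by transfer (metis zero_neq_one)
  show "(f + g) * h = f * h + g * h"
    by transfer (simp add: distrib_right sum.distrib case_prod_beta)
  show "1 * f = f"
  proof (transfer, rule ext)
    fix f :: "nat multiset \<Rightarrow> 'a" and M
    have "(\<Sum>(A, B) | A + B = M. (if A = {#} then 1 else 0) * f B)
        = (\<Sum>(A, B) \<in> {({#} :: nat multiset, M)}. (if A = {#} then 1 else 0) * f B)"
      by (rule sum.mono_neutral_right) (auto simp: finite_mset_sum_eq split: if_splits)
    then show "(\<Sum>(A, B) | A + B = M. (if A = {#} then 1 else 0) * f B) = f M"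
      by simp
  qed
  show "f * g = g * f"
  proof (transfer, rule ext)
    fix f g :: "nat multiset \<Rightarrow> 'a" and M
    show "(\<Sum>(A, B) | A + B = M. f A * g B) = (\<Sum>(A, B) | A + B = M. g A * f B)"
      by (rule sum.reindex_bij_witness[of _ prod.swap prod.swap])
        (auto simp: add.commute mult.commute)
  qed
  show "f * g * h = f * (g * h)"
  proof (transfer, rule ext)
    fix f g h :: "nat multiset \<Rightarrow> 'a" and M
    let ?D = "\<lambda>M. {(A, B). A + B = (M :: nat multiset)}"
    have fin: "finite (?D M)" for M
      by (rule finite_mset_sum_eq)
    have "(\<Sum>(A, C) \<in> ?D M. (\<Sum>(A, B) \<in> ?D A. f A * g B) * h C)
        = (\<Sum>p \<in> ?D M. \<Sum>q \<in> ?D (fst p). f (fst q) * g (snd q) * h (snd p))"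
      by (simp add: case_prod_beta sum_distrib_right)
    also have "\<dots> = (\<Sum>(p, q) \<in> Sigma (?D M) (\<lambda>p. ?D (fst p)). f (fst q) * g (snd q) * h (snd p))"
      by (rule sum.Sigma) (use fin in auto)
    also have "\<dots> = (\<Sum>(p, q) \<in> Sigma (?D M) (\<lambda>p. ?D (snd p)). f (fst p) * (g (fst q) * h (snd q)))"
      by (rule sum.reindex_bij_witness
            [of _ "\<lambda>((A, _), (B, C)). ((A + B, C), (A, B))" "\<lambda>((_, C), (A, B)). ((A, B + C), (B, C))"])
        (auto simp: add.assoc mult.assoc)
    also have "\<dots> = (\<Sum>p \<in> ?D M. \<Sum>q \<in> ?D (snd p). f (fst p) * (g (fst q) * h (snd q)))"
      by (rule sum.Sigma[symmetric]) (use fin in auto)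
    also have "\<dots> = (\<Sum>(A, C) \<in> ?D M. f A * (\<Sum>(A, B) \<in> ?D C. g A * h B))"
      by (simp add: case_prod_beta sum_distrib_left)
    finally show "(\<Sum>(A, C) \<in> ?D M. (\<Sum>(A, B) \<in> ?D A. f A * g B) * h C)
        = (\<Sum>(A, C) \<in> ?D M. f A * (\<Sum>(A, B) \<in> ?D C. g A * h B))" .
  qed
qed

end

lift_definition scale_sf :: "'a::comm_ring_1 \<Rightarrow> 'a symfun \<Rightarrow> 'a symfun" is "\<lambda>c f M. c * f M"
  unfolding symmetric_series_def by (metis mult_zero_right)

text \<open>\<open>p\<^sub>m = \<Sum>\<^sub>i x\<^sub>i\<^sup>m\<close>; only \<open>m \<ge> 1\<close> is meaningful.\<close>

lift_definition power_sum :: "nat \<Rightarrow> 'a::comm_ring_1 symfun"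
  is "\<lambda>m M. if \<exists>i. M = replicate_mset m i then 1 else 0"
proof -
  fix m :: nat
  have *: "(\<exists>i. image_mset \<pi> M = replicate_mset m i) \<longleftrightarrow> (\<exists>i. M = replicate_mset m i)"
    if "bij \<pi>" for \<pi> :: "nat \<Rightarrow> nat" and M
    by (metis image_mset_inv_bij[OF that] image_replicate_mset)
  show "symmetric_series (\<lambda>M. if \<exists>i. M = replicate_mset m i then 1 else (0::'a))"
    unfolding symmetric_series_def by (intro conjI exI[of _ m]) (auto simp: *)
qed

text \<open>A partition is the multiset of its parts: \<open>p\<^sub>\<mu> = p\<^bsub>\<mu>\<^sub>1\<^esub> p\<^bsub>\<mu>\<^sub>2\<^esub> \<dots>\<close>.\<close>

definition power_sum_part :: "nat multiset \<Rightarrow> 'a::comm_ring_1 symfun" where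
  "power_sum_part \<mu> = (\<Prod>m\<in>#\<mu>. power_sum m)"

text \<open>
  \<open>p\<^sub>m \<circ> h = h(x\<^sub>0\<^sup>m, x\<^sub>1\<^sup>m, \<dots>)\<close> for \<open>m \<ge> 1\<close>: the monomial \<open>N\<close> is replaced by its \<open>m\<close>-th power, which
  is \<^term>\<open>repeat_mset m N\<close>, so the sum below has at most one term.  (For \<open>m = 0\<close> it is \<open>0\<close>.)
\<close>

lift_definition adams :: "nat \<Rightarrow> 'a::comm_ring_1 symfun \<Rightarrow> 'a symfun"
  is "\<lambda>m h M. \<Sum>N | repeat_mset m N = M. h N"
proof -
  fix m :: nat and h :: "nat multiset \<Rightarrow> 'a"
  assume *: "symmetric_series h"
  then obtain d where d: "\<And>M. h M \<noteq> 0 \<Longrightarrow> size M \<le> d"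
    by (auto simp: symmetric_series_def)
  have image_repeat: "image_mset \<pi> (repeat_mset m N) = repeat_mset m (image_mset \<pi> N)"
    for \<pi> :: "nat \<Rightarrow> nat" and N
    by (induction m) simp_all
  have size_repeat: "size (repeat_mset m N) = m * size N" for N :: "nat multiset"
    by (induction m) simp_all
  have "(\<Sum>N | repeat_mset m N = image_mset \<pi> M. h N) = (\<Sum>N | repeat_mset m N = M. h N)"
    if \<pi>: "bij \<pi>" for \<pi> M
  proof (rule sum.reindex_bij_witness[of _ "image_mset \<pi>" "image_mset (inv' \<pi>)"])
    fix N assume "N \<in> {N. repeat_mset m N = image_mset \<pi> M}"
    then show "h (image_mset (inv' \<pi>) N) = h N"
      using * bij_imp_bij_inv[OF \<pi>] by (auto simp: symmetric_series_def)
  qed (auto simp: image_mset_inv_bij[OF \<pi>] simp flip: image_repeat)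
  moreover have "size M \<le> m * d" if nz: "(\<Sum>N | repeat_mset m N = M. h N) \<noteq> 0" for M
  proof -
    obtain N where "repeat_mset m N = M" "h N \<noteq> 0"
      using nz by (metis (mono_tags, lifting) mem_Collect_eq sum.not_neutral_contains_not_neutral)
    then show ?thesis
      using d[of N] by (auto simp: size_repeat)
  qed
  ultimately show "symmetric_series (\<lambda>M. \<Sum>N | repeat_mset m N = M. h N)"
    unfolding symmetric_series_def by blast
qed

lemma adams_power_sum:
  assumes "0 < m" "0 < n"
  shows "adams m (power_sum n) = power_sum (m * n)"
proof (transfer fixing: m n, rule ext)
  fix M :: "nat multiset"
  have inj: "N = N'" if "repeat_mset m N = repeat_mset m N'" for N N' :: "nat multiset"
    using that \<open>0 < m\<close> by (metis count_repeat_mset multiset_eqI mult_cancel1 not_gr_zero)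
  have rep: "repeat_mset m (replicate_mset n i) = replicate_mset (m * n) i" for i :: nat
    by (intro multiset_eqI) simp
  show "(\<Sum>N | repeat_mset m N = M. if \<exists>i. N = replicate_mset n i then 1 else (0::'a))
      = (if \<exists>i. M = replicate_mset (m * n) i then 1 else 0)"
  proof (cases "\<exists>N. repeat_mset m N = M")
    case True
    then obtain N where N: "repeat_mset m N = M"
      by blast
    then have "{N. repeat_mset m N = M} = {N}"
      using inj by auto
    moreover have "(\<exists>i. N = replicate_mset n i) \<longleftrightarrow> (\<exists>i. M = replicate_mset (m * n) i)"
      using N rep inj by metis
    ultimately show ?thesis
      by simp
  next
    case False
    then have "{N. repeat_mset m N = M} = {}" "\<nexists>i. M = replicate_mset (m * n) i"
      using rep by auto
    then show ?thesis
      by simp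
  qed
qed

text \<open>
  In characteristic \<open>0\<close> the \<open>p\<^sub>\<mu>\<close> (\<open>\<mu>\<close> a partition) form a basis of \<open>\<Lambda>\<close>, so every \<open>g\<close> has exactly one
  expansion \<open>g = \<Sum>\<^sub>\<mu> c\<^sub>\<mu> p\<^sub>\<mu>\<close>.  As \<open>g \<mapsto> g \<circ> h\<close> is an algebra homomorphism,
  \<open>g \<circ> h = \<Sum>\<^sub>\<mu> c\<^sub>\<mu> \<Prod>\<^sub>i (p\<^bsub>\<mu>\<^sub>i\<^esub> \<circ> h)\<close>.
\<close>

definition power_sum_expansion :: "'a::field_char_0 symfun \<Rightarrow> (nat multiset \<Rightarrow> 'a) \<Rightarrow> bool" where
  "power_sum_expansion g c \<longleftrightarrow>
     finite {\<mu>. c \<mu> \<noteq> 0} \<and> (\<forall>\<mu>. c \<mu> \<noteq> 0 \<longrightarrow> 0 \<notin># \<mu>) \<and>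
     g = (\<Sum>\<mu> | c \<mu> \<noteq> 0. scale_sf (c \<mu>) (power_sum_part \<mu>))"

definition plethysm :: "'a::field_char_0 symfun \<Rightarrow> 'a symfun \<Rightarrow> 'a symfun" where
  "plethysm g h =
     (let c = (THE c. power_sum_expansion g c)
      in \<Sum>\<mu> | c \<mu> \<noteq> 0. scale_sf (c \<mu>) (\<Prod>m\<in>#\<mu>. adams m h))"


section \<open>Characters of symmetric groups\<close>

text \<open>Class functions are extensional, so that equality on the group is equality of functions.\<close>

definition class_functions :: "('g, 'm) monoid_scheme \<Rightarrow> ('g \<Rightarrow> complex) set" where
  "class_functions G =
     {\<phi> \<in> extensional (carrier G).
        \<forall>u\<in>carrier G. \<forall>w\<in>carrier G. \<phi> (u \<otimes>\<^bsub>G\<^esub> w \<otimes>\<^bsub>G\<^esub> inv\<^bsub>G\<^esub> u) = \<phi> w}"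

text \<open>
  The permutation representation of \<open>G\<close> on \<open>X\<close> via the action \<open>\<phi>\<close>, as matrices indexed by \<open>X\<close>:
  \<open>g\<close> maps the basis vector \<open>e\<^sub>t\<close> to \<open>e\<^bsub>\<phi> g t\<^esub>\<close>.  Its character is the trace.
\<close>

definition perm_matrix :: "('g \<Rightarrow> 'x \<Rightarrow> 'x) \<Rightarrow> 'g \<Rightarrow> 'x \<Rightarrow> 'x \<Rightarrow> complex" where
  "perm_matrix \<phi> g s t = of_bool (s = \<phi> g t)"

definition perm_character ::
    "('g, 'm) monoid_scheme \<Rightarrow> ('g \<Rightarrow> 'x \<Rightarrow> 'x) \<Rightarrow> 'x set \<Rightarrow> 'g \<Rightarrow> complex" where
  "perm_character G \<phi> X = (\<lambda>g\<in>carrier G. \<Sum>t\<in>X. perm_matrix \<phi> g t t)"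

definition trivial_character :: "('g, 'm) monoid_scheme \<Rightarrow> 'g \<Rightarrow> complex" where
  "trivial_character G = (\<lambda>g\<in>carrier G. 1)"

text \<open>The cycles of \<open>w\<close> on \<open>[n]\<close>, fixed points included, are the orbits \<open>{w\<^sup>j i | j > 0}\<close>.\<close>

definition cycle_type :: "nat \<Rightarrow> (nat \<Rightarrow> nat) \<Rightarrow> nat multiset" where
  "cycle_type n w = image_mset card (mset_set (Orbits.orbit w ` {1..n}))"

definition frobenius_ch :: "nat \<Rightarrow> ((nat \<Rightarrow> nat) \<Rightarrow> complex) \<Rightarrow> complex symfun" where
  "frobenius_ch n \<phi> =
     scale_sf (1 / fact n)
       (\<Sum>w\<in>carrier (sym_group n). scale_sf (\<phi> w) (power_sum_part (cycle_type n w)))"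

text \<open>
  For class functions \<open>\<chi>\<close> of \<open>S\<^sub>m\<close> and \<open>\<psi>\<close> of \<open>S\<^sub>k\<close>, the class function \<open>\<chi> \<circ> \<psi>\<close> of \<open>S\<^bsub>mk\<^esub>\<close> with
  \<open>ch (\<chi> \<circ> \<psi>) = ch \<chi> \<circ> ch \<psi>\<close>.
\<close>

definition char_plethysm ::
    "nat \<Rightarrow> nat \<Rightarrow> ((nat \<Rightarrow> nat) \<Rightarrow> complex) \<Rightarrow> ((nat \<Rightarrow> nat) \<Rightarrow> complex) \<Rightarrow> (nat \<Rightarrow> nat) \<Rightarrow> complex" where
  "char_plethysm m k \<chi> \<psi> =
     inv_into (class_functions (sym_group (m * k))) (frobenius_ch (m * k))
       (plethysm (frobenius_ch m \<chi>) (frobenius_ch k \<psi>))"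


section \<open>Rooted forests\<close>

record 'v graph_with_roots =
  verts :: "'v set"
  edges :: "'v set set"
  roots :: "'v set"

definition component_of :: "'v graph_with_roots \<Rightarrow> 'v \<Rightarrow> 'v set" where
  "component_of F v = {u \<in> verts F. (\<lambda>a b. {a, b} \<in> edges F)\<^sup>*\<^sup>* v u}"

definition components :: "'v graph_with_roots \<Rightarrow> 'v set set" where
  "components F = component_of F ` verts F"

definition is_cycle :: "'v graph_with_roots \<Rightarrow> 'v list \<Rightarrow> bool" where
  "is_cycle F vs \<longleftrightarrow>
     3 \<le> length vs \<and> distinct vs \<and>
     (\<forall>i<length vs. {vs ! i, vs ! (Suc i mod length vs)} \<in> edges F)"

definition rooted_forest :: "'v graph_with_roots \<Rightarrow> bool" where
  "rooted_forest F \<longleftrightarrow>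
     edges F \<subseteq> {{u, v} |u v. u \<in> verts F \<and> v \<in> verts F \<and> u \<noteq> v} \<and>
     (\<nexists>vs. is_cycle F vs) \<and>
     roots F \<subseteq> verts F \<and>
     (\<forall>C\<in>components F. \<exists>!\<rho>. \<rho> \<in> roots F \<inter> C)"

definition rooted_tree :: "'v graph_with_roots \<Rightarrow> bool" where
  "rooted_tree T \<longleftrightarrow> rooted_forest T \<and> (\<exists>!C. C \<in> components T)"

definition relabel :: "('v \<Rightarrow> 'w) \<Rightarrow> 'v graph_with_roots \<Rightarrow> 'w graph_with_roots" where
  "relabel f F =
     \<lparr>verts = f ` verts F, edges = (\<lambda>e. f ` e) ` edges F, roots = f ` roots F\<rparr>"

definition isomorphic_rooted :: "'v graph_with_roots \<Rightarrow> 'w graph_with_roots \<Rightarrow> bool" where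
  "isomorphic_rooted F F' \<longleftrightarrow> (\<exists>f. inj_on f (verts F) \<and> relabel f F = F')"

definition restrict_to :: "'v graph_with_roots \<Rightarrow> 'v set \<Rightarrow> 'v graph_with_roots" where
  "restrict_to F C = \<lparr>verts = C, edges = {e \<in> edges F. e \<subseteq> C}, roots = roots F \<inter> C\<rparr>"

definition consists_of_copies ::
    "'v graph_with_roots \<Rightarrow> nat \<Rightarrow> 'w graph_with_roots \<Rightarrow> bool" where
  "consists_of_copies F r T \<longleftrightarrow>
     card (components F) = r \<and> (\<forall>C\<in>components F. isomorphic_rooted (restrict_to F C) T)"

text \<open>The character of \<open>o(\<sigma>)\<close>, the permutation representation of \<open>S\<^sub>n\<close> on the orbit of \<open>\<sigma>\<close>.\<close>

definition orbit_character :: "nat \<Rightarrow> nat graph_with_roots \<Rightarrow> (nat \<Rightarrow> nat) \<Rightarrow> complex" where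
  "orbit_character n \<sigma> =
     perm_character (sym_group n) relabel (Group_Action.orbit (sym_group n) relabel \<sigma>)"

end

theory Submission
  imports Defs
begin

text \<open>
  Symmetric functions are compared coefficientwise.  The power sum product of the cycle type of
  \<open>w \<in> S\<^sub>n\<close> is the generating function of the colourings \<open>[n] \<rightarrow> \<nat>\<close> that \<open>w\<close> fixes, so by Burnside's lemma
  the characteristic of a permutation representation of \<open>S\<^sub>n\<close> on \<open>X\<close> is the generating function, by
  content, of the \<open>S\<^sub>n\<close>-orbits of pairs (element of \<open>X\<close>, colouring).  In the same way, if \<open>g\<close> is the
  generating function of a weighted set \<open>J\<close>, then \<open>ch \<chi>\<^bsup>(r)\<^esup> \<circ> g\<close> is that of the \<open>S\<^sub>r\<close>-orbits of functions
  \<open>[r] \<rightarrow> J\<close>.  The orbits of coloured copies of \<open>\<sigma>\<close> correspond to the multisets of \<open>r\<close> orbits of coloured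
  copies of \<open>\<tau>\<close>, since an automorphism of \<open>\<sigma>\<close> permutes the components and then acts on each by an
  automorphism of \<open>\<tau>\<close>; hence both sides have the same characteristic.  Finally \<open>ch\<close> is injective
  on class functions, because the \<open>p\<^sub>\<mu>\<close> are linearly independent and permutations of equal cycle type
  are conjugate.
\<close>

section \<open>Generating series\<close>

text \<open>The body expresses \<open>g\<close> as the sum over \<open>j\<close> in \<open>J\<close>
  of the monomials \<open>wt j\<close>, where \<open>J\<close> may be infinite. Finiteness of the
  fibres has to be demanded separately, because \<open>card\<close> of an infinite set is 0.\<close>

definition gen_series :: "'a::comm_ring_1 symfun \<Rightarrow> 'j set \<Rightarrow> ('j \<Rightarrow> nat multiset) \<Rightarrow> bool" where
  "gen_series g J wt \<longleftrightarrow>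
     (\<forall>M. finite {j\<in>J. wt j = M} \<and> coeff_sf g M = of_nat (card {j\<in>J. wt j = M}))"

lemma gen_series_finite: "gen_series g J wt \<Longrightarrow> finite {j\<in>J. wt j = M}"
  and gen_series_coeff: "gen_series g J wt \<Longrightarrow> coeff_sf g M = of_nat (card {j\<in>J. wt j = M})"
  by (auto simp: gen_series_def)

lemma gen_series_bij:
  assumes "gen_series g J wt" "bij_betw h I J" "\<And>i. i \<in> I \<Longrightarrow> wt' i = wt (h i)"
  shows "gen_series g I wt'"
  unfolding gen_series_def
proof
  fix M
  have b: "bij_betw h {i\<in>I. wt' i = M} {j\<in>J. wt j = M}"
    using assms(2,3) unfolding bij_betw_def inj_on_def by auto
  show "finite {i\<in>I. wt' i = M} \<and> coeff_sf g M = of_nat (card {i\<in>I. wt' i = M})"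
    using bij_betw_finite[OF b] bij_betw_same_card[OF b] assms(1) by (simp add: gen_series_def)
qed

lemma gen_series_one: "gen_series 1 {x} (\<lambda>_. {#})"
proof -
  have "{j\<in>{x}. {#} = M} = (if M = {#} then {x} else {})" for M :: "nat multiset"
    by auto
  then show ?thesis
    unfolding gen_series_def one_symfun.rep_eq by simp
qed

text \<open>The pairs of weight \<open>M\<close> split into disjoint products of fibres over the
  finitely many decompositions \<open>A + B = M\<close>, which is the convolution defining the
  product.\<close>

lemma gen_series_times:
  assumes "gen_series f I u" "gen_series g J v"
  shows "gen_series (f * g) (I \<times> J) (\<lambda>(i, j). u i + v j)"
  unfolding gen_series_def
proof
  fix M
  let ?D = "{(A, B). A + B = (M :: nat multiset)}"
  let ?X = "\<lambda>A. {i\<in>I. u i = A}" and ?Y = "\<lambda>B. {j\<in>J. v j = B}"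
  let ?Z = "\<lambda>p. ?X (fst p) \<times> ?Y (snd p)"
  have eq: "{p \<in> I \<times> J. (case p of (i, j) \<Rightarrow> u i + v j) = M} = (\<Union>p\<in>?D. ?Z p)"
    by auto
  have fin: "finite (?Z p)" for p
    using assms by (simp add: gen_series_finite)
  have "coeff_sf (f * g) M = (\<Sum>p\<in>?D. of_nat (card (?Z p)))"
    unfolding times_symfun.rep_eq
    by (intro sum.cong) (auto simp: gen_series_coeff[OF assms(1)] gen_series_coeff[OF assms(2)] card_cartesian_product)
  also have "\<dots> = of_nat (card (\<Union>p\<in>?D. ?Z p))"
    unfolding of_nat_sum[symmetric]
    by (subst card_UN_disjoint) (use fin in \<open>auto simp: finite_mset_sum_eq\<close>)
  finally show "finite {p \<in> I \<times> J. (case p of (i, j) \<Rightarrow> u i + v j) = M} \<and>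
      coeff_sf (f * g) M = of_nat (card {p \<in> I \<times> J. (case p of (i, j) \<Rightarrow> u i + v j) = M})"
    unfolding eq using fin by (simp add: finite_mset_sum_eq)
qed

lemma gen_series_prod:
  assumes "finite Q" "\<And>q. q \<in> Q \<Longrightarrow> gen_series (g q) (J q) (wt q)"
  shows "gen_series (\<Prod>q\<in>Q. g q) (PiE Q J) (\<lambda>f. \<Sum>q\<in>Q. wt q (f q))"
  using assms
proof (induction Q rule: finite_induct)
  case empty
  then show ?case
    by (simp add: gen_series_one)
next
  case (insert q Q)
  have "gen_series (g q * (\<Prod>q\<in>Q. g q)) (J q \<times> PiE Q J) (\<lambda>(j, f). wt q j + (\<Sum>q\<in>Q. wt q (f q)))"
    using insert by (intro gen_series_times) auto
  moreover have "bij_betw (\<lambda>f. (f q, f(q := undefined))) (PiE (insert q Q) J) (J q \<times> PiE Q J)"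
  proof (rule bij_betw_byWitness[where f' = "\<lambda>(j, f). f(q := j)"])
    show "\<forall>p\<in>J q \<times> PiE Q J. (\<lambda>f. (f q, f(q := undefined))) ((\<lambda>(j, f). f(q := j)) p) = p"
      using insert.hyps by (auto simp: PiE_def extensional_def fun_eq_iff)
    show "(\<lambda>f. (f q, f(q := undefined))) ` PiE (insert q Q) J \<subseteq> J q \<times> PiE Q J"
      using insert.hyps by (fastforce simp: PiE_def extensional_def)
  qed (auto simp: PiE_def extensional_def)
  ultimately have "gen_series (g q * (\<Prod>q\<in>Q. g q)) (PiE (insert q Q) J)
      (\<lambda>f. wt q (f q) + (\<Sum>x\<in>Q. wt x (f x)))"
    using insert.hyps by (elim gen_series_bij) (auto intro!: sum.cong)
  then show ?case
    using insert.hyps by simp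
qed

lemma repeat_mset_inject: "0 < m \<Longrightarrow> repeat_mset m A = repeat_mset m B \<longleftrightarrow> A = B"
  by (metis count_repeat_mset multiset_eqI mult_cancel1 not_gr_zero)

text \<open>For positive \<open>m\<close>, \<open>repeat_mset m\<close> is injective, so the fibre
  over \<open>M\<close> is one whole fibre of \<open>wt\<close> or empty, just as the sum defining
  \<open>adams\<close> has one term or none.\<close>

lemma gen_series_adams:
  assumes "gen_series g J wt" "0 < m"
  shows "gen_series (adams m g) J (\<lambda>j. repeat_mset m (wt j))"
  unfolding gen_series_def
proof
  fix M
  show "finite {j\<in>J. repeat_mset m (wt j) = M} \<and>
      coeff_sf (adams m g) M = of_nat (card {j\<in>J. repeat_mset m (wt j) = M})"
  proof (cases "\<exists>N. repeat_mset m N = M")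
    case True
    then obtain N where N: "repeat_mset m N = M" by blast
    have 1: "{N. repeat_mset m N = M} = {N}"
      using repeat_mset_inject[OF assms(2)] N by auto
    have 2: "{j\<in>J. repeat_mset m (wt j) = M} = {j\<in>J. wt j = N}"
      using repeat_mset_inject[OF assms(2)] N by auto
    show ?thesis
      unfolding adams.rep_eq 1 2 using assms(1) by (simp add: gen_series_def)
  next
    case False
    then have 1: "{N. repeat_mset m N = M} = {}" and 2: "{j\<in>J. repeat_mset m (wt j) = M} = {}"
      by auto
    show ?thesis
      unfolding adams.rep_eq 1 2 by simp
  qed
qed

lemma gen_series_power_sum:
  assumes "0 < m"
  shows "gen_series (power_sum m) UNIV (\<lambda>i. replicate_mset m i)"
  unfolding gen_series_def
proof
  fix M
  show "finite {i\<in>UNIV. replicate_mset m i = M} \<and>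
      coeff_sf (power_sum m :: 'a symfun) M = of_nat (card {i\<in>UNIV. replicate_mset m i = M})"
  proof (cases "\<exists>i. M = replicate_mset m i")
    case True
    then obtain i where i: "M = replicate_mset m i" by blast
    have "{j\<in>UNIV. replicate_mset m j = M} = {i}"
      using assms unfolding i by (auto simp: replicate_mset_eq_iff)
    then show ?thesis
      using True unfolding power_sum.rep_eq by simp
  next
    case False
    then have "{j\<in>UNIV. replicate_mset m j = M} = {}"
      by auto
    then show ?thesis
      using False unfolding power_sum.rep_eq by simp
  qed
qed

lemma coeff_sum_sf: "coeff_sf (\<Sum>x\<in>X. g x) M = (\<Sum>x\<in>X. coeff_sf (g x) M)"
  by (induction X rule: infinite_finite_induct) (simp_all add: zero_symfun.rep_eq plus_symfun.rep_eq)

lemma symfun_eqI: "(\<And>M. coeff_sf g M = coeff_sf h M) \<Longrightarrow> g = h"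
  by (simp add: coeff_sf_inject[symmetric] fun_eq_iff)

section \<open>Linear independence of the power sums\<close>

text \<open>Expanding the product picks one variable for each part of \<nu>. A monomial therefore
  has at most \<open>size \<nu>\<close> distinct variables; if it has that many, no variable is
  shared and the exponents are the parts themselves.\<close>

lemma coeff_power_sum_part_nonzero:
  assumes "coeff_sf (power_sum_part \<nu>) M \<noteq> (0 :: 'a::comm_ring_1)"
  shows "card (set_mset M) \<le> size \<nu>"
    and "card (set_mset M) = size \<nu> \<Longrightarrow> image_mset (count M) (mset_set (set_mset M)) = \<nu>"
proof -
  have "card (set_mset M) \<le> size \<nu> \<and>
      (card (set_mset M) = size \<nu> \<longrightarrow> image_mset (count M) (mset_set (set_mset M)) = \<nu>)"
    using assms
  proof (induction \<nu> arbitrary: M)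
    case empty
    then show ?case
      by (auto simp: power_sum_part_def one_symfun.rep_eq split: if_splits)
  next
    case (add m \<nu>)
    have "(\<Sum>(A, B) | A + B = M.
        coeff_sf (power_sum m) A * coeff_sf (power_sum_part \<nu>) B) \<noteq> (0 :: 'a)"
      using add.prems by (simp add: power_sum_part_def times_symfun.rep_eq)
    then obtain A B where AB: "A + B = M" "coeff_sf (power_sum m) A \<noteq> (0 :: 'a)"
        "coeff_sf (power_sum_part \<nu>) B \<noteq> (0 :: 'a)"
      by (smt (verit) case_prodE mem_Collect_eq mult_zero_left mult_zero_right
          sum.not_neutral_contains_not_neutral case_prod_conv)
    then obtain i where i: "A = replicate_mset m i"
      by (auto simp: power_sum.rep_eq split: if_splits)
    note IH = add.IH[OF AB(3)]
    have sub: "set_mset M \<subseteq> insert i (set_mset B)"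
      using AB(1) i by (auto split: if_splits)
    then have le: "card (set_mset M) \<le> card (insert i (set_mset B))"
      by (intro card_mono) auto
    also have "\<dots> \<le> Suc (card (set_mset B))"
      by (simp add: card_insert_if)
    finally have le': "card (set_mset M) \<le> Suc (card (set_mset B))" .
    show ?case
    proof (intro conjI impI)
      show "card (set_mset M) \<le> size (add_mset m \<nu>)"
        using le' IH by simp
      assume eq: "card (set_mset M) = size (add_mset m \<nu>)"
      \<comment> \<open>With \<open>Suc (size \<nu>)\<close> distinct variables in \<open>M\<close>,
        the new part cannot reuse a variable of \<open>B\<close>.\<close>
      have iB: "i \<notin># B"
        using eq le IH by (auto simp: insert_absorb)
      have B: "card (set_mset B) = size \<nu>"
        using eq le' IH by simp
      have M: "set_mset M = insert i (set_mset B)"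
        by (rule card_seteq) (use sub eq B iB in auto)
      have "count M i = m" and "\<And>x. x \<in># B \<Longrightarrow> count M x = count B x"
        using AB(1) i iB by (auto simp: count_eq_zero_iff)
      then show "image_mset (count M) (mset_set (set_mset M)) = add_mset m \<nu>"
        unfolding M using iB IH B by (auto intro: image_mset_cong simp del: count_union)
    qed
  qed
  then show "card (set_mset M) \<le> size \<nu>"
    and "card (set_mset M) = size \<nu> \<Longrightarrow> image_mset (count M) (mset_set (set_mset M)) = \<nu>"
    by auto
qed

lemma prod_nth_mset:
  fixes f :: "'b \<Rightarrow> 'a::comm_monoid_mult"
  shows "(\<Prod>q<length xs. f (xs ! q)) = (\<Prod>m\<in>#mset xs. f m)"
  by (induction xs rule: rev_induct) (simp_all add: nth_append mult.commute cong: prod.cong_simp)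

text \<open>The witness is the monomial \<open>\<Prod>\<^sub>i x\<^sub>i\<^bsup>\<nu>\<^sub>i\<^esup>\<close>, with a variable of its own for every part.\<close>

lemma ex_leading_monomial:
  assumes "0 \<notin># \<nu>"
  obtains M where "card (set_mset M) = size \<nu>"
    "coeff_sf (power_sum_part \<nu>) M \<noteq> (0 :: 'a::{comm_ring_1, ring_char_0})"
proof -
  obtain xs where xs: "mset xs = \<nu>"
    using ex_mset by blast
  define M where "M = (\<Sum>q<length xs. replicate_mset (xs ! q) q)"
  have nz: "xs ! q > 0" if "q < length xs" for q
    using assms that xs by (metis gr0I nth_mem_mset)
  have "set_mset M = {..<length xs}"
    using nz by (auto simp: M_def set_mset_sum split: if_splits)
  then have card: "card (set_mset M) = size \<nu>"
    unfolding xs[symmetric] by simp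
  have gs: "gen_series (\<Prod>q<length xs. power_sum (xs ! q) :: 'a symfun) (PiE {..<length xs} (\<lambda>_. UNIV))
      (\<lambda>f. \<Sum>q<length xs. replicate_mset (xs ! q) (f q))"
  proof (rule gen_series_prod[where wt = "\<lambda>q. replicate_mset (xs ! q)"])
    show "gen_series (power_sum (xs ! q) :: 'a symfun) UNIV (replicate_mset (xs ! q))"
      if "q \<in> {..<length xs}" for q
      by (rule gen_series_power_sum) (use nz that in auto)
  qed simp
  have prod: "(\<Prod>q<length xs. power_sum (xs ! q) :: 'a symfun) = power_sum_part \<nu>"
    unfolding power_sum_part_def xs[symmetric]
    by (rule prod_nth_mset)
  let ?F = "{f\<in>PiE {..<length xs} (\<lambda>_. UNIV). (\<Sum>q<length xs. replicate_mset (xs ! q) (f q)) = M}"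
  have "finite ?F"
    using gs by (rule gen_series_finite)
  \<comment> \<open>The coefficient counts the assignments of variables to parts with product
    \<open>M\<close>. The identity assignment is one of them, and in characteristic 0 a positive
    count stays nonzero.\<close>
  moreover have "(\<lambda>q\<in>{..<length xs}. q) \<in> ?F"
    by (auto simp: M_def)
  ultimately have "card ?F \<noteq> 0"
    using card_0_eq by blast
  then have "coeff_sf (power_sum_part \<nu> :: 'a symfun) M \<noteq> 0"
    using gen_series_coeff[OF gs, of M] unfolding prod by simp
  with card that show ?thesis
    by blast
qed

text \<open>Among the partitions with nonzero coefficient take a longest one, \<mu>, and a monomial
  of its power sum product with as many variables as \<mu> has parts. Another \<kappa> of the sum
  whose product contains this monomial would have the same length, and then the exponents would
  force \<kappa> to be \<mu>.\<close>

lemma power_sum_part_independent: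
  fixes c :: "nat multiset \<Rightarrow> 'a::field_char_0"
  assumes "finite S" "\<And>\<mu>. \<mu> \<in> S \<Longrightarrow> 0 \<notin># \<mu>"
    and zero: "(\<Sum>\<mu>\<in>S. scale_sf (c \<mu>) (power_sum_part \<mu>)) = 0"
    and "\<nu> \<in> S"
  shows "c \<nu> = 0"
proof (rule ccontr)
  assume "c \<nu> \<noteq> 0"
  define T where "T = {\<mu>\<in>S. c \<mu> \<noteq> 0}"
  have "finite T" "\<nu> \<in> T"
    using assms \<open>c \<nu> \<noteq> 0\<close> by (auto simp: T_def)
  then obtain \<mu> where \<mu>: "\<mu> \<in> T" "\<And>\<kappa>. \<kappa> \<in> T \<Longrightarrow> size \<kappa> \<le> size \<mu>"
    using obtains_MAX[of T size] Max_ge[of "size ` T"] by (metis empty_iff finite_imageI imageI)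
  obtain M where M: "card (set_mset M) = size \<mu>" "coeff_sf (power_sum_part \<mu>) M \<noteq> (0::'a)"
    using ex_leading_monomial[of \<mu>] \<mu>(1) assms(2) by (auto simp: T_def)
  have "c \<kappa> * coeff_sf (power_sum_part \<kappa>) M = 0" if "\<kappa> \<in> S" "\<kappa> \<noteq> \<mu>" for \<kappa>
  proof (rule ccontr)
    assume "c \<kappa> * coeff_sf (power_sum_part \<kappa>) M \<noteq> 0"
    then have nz: "c \<kappa> \<noteq> 0" "coeff_sf (power_sum_part \<kappa>) M \<noteq> (0::'a)"
      by auto
    then have "size \<kappa> = size \<mu>"
      using that \<mu>(2)[of \<kappa>] coeff_power_sum_part_nonzero(1)[OF nz(2)] M(1) by (simp add: T_def)
    then have "\<kappa> = \<mu>"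
      using coeff_power_sum_part_nonzero(2)[OF nz(2)] coeff_power_sum_part_nonzero(2)[OF M(2)] M(1)
      by metis
    with that show False by simp
  qed
  then have "coeff_sf (\<Sum>\<mu>\<in>S. scale_sf (c \<mu>) (power_sum_part \<mu>)) M = (\<Sum>\<kappa>\<in>{\<mu>}. c \<kappa> * coeff_sf (power_sum_part \<kappa>) M)"
    unfolding coeff_sum_sf scale_sf.rep_eq
    using \<mu>(1) \<open>finite S\<close> by (intro sum.mono_neutral_right) (auto simp: T_def)
  then show False
    using M(2) \<mu>(1) unfolding zero by (simp add: zero_symfun.rep_eq T_def)
qed

section \<open>Expansions in power sums and plethysm\<close>

lemmas coeff_sf_simps = scale_sf.rep_eq plus_symfun.rep_eq zero_symfun.rep_eq
  uminus_symfun.rep_eq coeff_sum_sf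

lemma scale_sf_diff: "scale_sf a g - scale_sf b g = scale_sf (a - b) g"
  unfolding minus_symfun_def by (rule symfun_eqI) (simp add: coeff_sf_simps left_diff_distrib del: add_uminus_conv_diff)

lemma scale_sf_zero: "scale_sf 0 g = 0"
  by (rule symfun_eqI) (simp add: coeff_sf_simps)

lemma scale_sf_sum: "scale_sf a (\<Sum>x\<in>X. g x) = (\<Sum>x\<in>X. scale_sf a (g x))"
  by (rule symfun_eqI) (simp add: coeff_sf_simps sum_distrib_left)

lemma scale_sf_sum_left: "scale_sf (\<Sum>x\<in>X. b x) h = (\<Sum>x\<in>X. scale_sf (b x) h)"
  by (rule symfun_eqI) (simp add: coeff_sf_simps sum_distrib_right)

lemma scale_sf_scale_sf: "scale_sf a (scale_sf b h) = scale_sf (a * b) h"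
  by (rule symfun_eqI) (simp add: coeff_sf_simps mult.assoc)

lemma power_sum_expansion_unique:
  assumes "power_sum_expansion g c" "power_sum_expansion g d"
  shows "c = d"
proof
  fix \<nu>
  define S where "S = {\<mu>. c \<mu> \<noteq> 0} \<union> {\<mu>. d \<mu> \<noteq> 0}"
  note c = assms(1)[unfolded power_sum_expansion_def, THEN conjunct1]
      assms(1)[unfolded power_sum_expansion_def, THEN conjunct2, THEN conjunct1, rule_format]
      assms(1)[unfolded power_sum_expansion_def, THEN conjunct2, THEN conjunct2]
  note d = assms(2)[unfolded power_sum_expansion_def, THEN conjunct1]
      assms(2)[unfolded power_sum_expansion_def, THEN conjunct2, THEN conjunct1, rule_format]
      assms(2)[unfolded power_sum_expansion_def, THEN conjunct2, THEN conjunct2]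
  have S: "finite S" "\<And>\<mu>. \<mu> \<in> S \<Longrightarrow> 0 \<notin># \<mu>"
    using c(1) d(1) by (simp add: S_def) (use c(2) d(2) in \<open>auto simp: S_def\<close>)
  \<comment> \<open>Both expansions are padded with zero terms to the union of their supports, so
    that they can be subtracted termwise.\<close>
  have extend: "(\<Sum>\<mu> | b \<mu> \<noteq> 0. scale_sf (b \<mu>) (power_sum_part \<mu>)) =
      (\<Sum>\<mu>\<in>S. scale_sf (b \<mu>) (power_sum_part \<mu>))" if "{\<mu>. b \<mu> \<noteq> 0} \<subseteq> S" for b :: "nat multiset \<Rightarrow> 'a"
    using S(1) that by (intro sum.mono_neutral_left) (auto simp: scale_sf_zero)
  have "g = (\<Sum>\<mu>\<in>S. scale_sf (c \<mu>) (power_sum_part \<mu>))"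
    using c(3) extend[of c] unfolding S_def by simp
  moreover have "g = (\<Sum>\<mu>\<in>S. scale_sf (d \<mu>) (power_sum_part \<mu>))"
    using d(3) extend[of d] unfolding S_def by simp
  ultimately have "(\<Sum>\<mu>\<in>S. scale_sf (c \<mu> - d \<mu>) (power_sum_part \<mu>)) = 0"
    by (simp add: scale_sf_diff[symmetric] sum_subtractf)
  from power_sum_part_independent[OF S this] show "c \<nu> = d \<nu>"
    by (cases "\<nu> \<in> S") (auto simp: S_def)
qed

text \<open>Different \<open>w\<close> may give the same partition, so the sum is first collected
  into coefficients \<open>c \<nu>\<close>; uniqueness then identifies this \<open>c\<close> with
  the one selected by \<open>THE\<close>. The regrouping is proved for arbitrary \<open>F\<close>,
  as it serves both for \<open>power_sum_part\<close> and for the products of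
  \<open>adams\<close>.\<close>

lemma plethysm_sum:
  fixes a :: "'w \<Rightarrow> 'a::field_char_0"
  assumes "finite W" "\<And>w. w \<in> W \<Longrightarrow> 0 \<notin># \<mu> w"
  shows "plethysm (\<Sum>w\<in>W. scale_sf (a w) (power_sum_part (\<mu> w))) h =
    (\<Sum>w\<in>W. scale_sf (a w) (\<Prod>m\<in>#\<mu> w. adams m h))"
proof -
  define c where "c = (\<lambda>\<nu>. \<Sum>w | w \<in> W \<and> \<mu> w = \<nu>. a w)"
  have supp: "{\<nu>. c \<nu> \<noteq> 0} \<subseteq> \<mu> ` W"
    unfolding c_def by (auto elim!: sum.not_neutral_contains_not_neutral)
  have regroup: "(\<Sum>w\<in>W. scale_sf (a w) (F (\<mu> w))) = (\<Sum>\<nu> | c \<nu> \<noteq> 0. scale_sf (c \<nu>) (F \<nu>))"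
    for F :: "nat multiset \<Rightarrow> 'a symfun"
  proof -
    have "(\<Sum>w\<in>W. scale_sf (a w) (F (\<mu> w))) =
        (\<Sum>\<nu>\<in>\<mu> ` W. \<Sum>w | w \<in> W \<and> \<mu> w = \<nu>. scale_sf (a w) (F (\<mu> w)))"
      using assms(1) by (rule sum.image_gen)
    also have "\<dots> = (\<Sum>\<nu>\<in>\<mu> ` W. scale_sf (c \<nu>) (F \<nu>))"
      unfolding c_def scale_sf_sum_left by (intro sum.cong) auto
    also have "\<dots> = (\<Sum>\<nu> | c \<nu> \<noteq> 0. scale_sf (c \<nu>) (F \<nu>))"
      using supp assms(1) by (intro sum.mono_neutral_right) (auto simp: scale_sf_zero)
    finally show ?thesis .
  qed
  have "power_sum_expansion (\<Sum>w\<in>W. scale_sf (a w) (power_sum_part (\<mu> w))) c"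
    unfolding power_sum_expansion_def regroup
    using supp assms by (auto intro: finite_subset)
  then have the: "(THE c. power_sum_expansion (\<Sum>w\<in>W. scale_sf (a w) (power_sum_part (\<mu> w))) c) = c"
    by (auto intro: power_sum_expansion_unique)
  show ?thesis
    unfolding plethysm_def Let_def the by (rule regroup[symmetric])
qed

section \<open>Cycle types\<close>

lemma orbit_eq_iff_permutes:
  assumes "w permutes S" "finite S" "i \<in> S"
  shows "Q \<in> Orbits.orbit w ` S \<Longrightarrow> Orbits.orbit w i = Q \<longleftrightarrow> i \<in> Q"
proof -
  assume "Q \<in> Orbits.orbit w ` S"
  then have "cyclic_on w Q"
    using cyclic_on_orbit[OF assms(1,2)] by auto
  moreover have "i \<in> Orbits.orbit w i"
    using assms(1,2) permutation_permutes permutation_self_in_orbit by metis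
  ultimately show ?thesis
    using orbit_cyclic_eq3 by metis
qed

lemma cycle_fibre:
  assumes "w permutes S" "finite S" "Q \<in> Orbits.orbit w ` S"
  shows "{i\<in>S. Orbits.orbit w i = Q} = Q"
  using orbit_eq_iff_permutes[OF assms(1,2) _ assms(3)] permutes_orbit_subset[OF assms(1)] assms(3)
  by auto

lemma finite_cycle:
  assumes "w permutes S" "finite S" "Q \<in> Orbits.orbit w ` S"
  shows "finite Q" "card Q > 0"
proof -
  have "Q \<subseteq> S" "Q \<noteq> {}"
    using assms(3) permutes_orbit_subset[OF assms(1)] orbit_nonempty[of w] by blast+
  with \<open>finite S\<close> show "finite Q" "card Q > 0"
    by (auto simp: finite_subset card_gt_0_iff)
qed

lemma zero_notin_cycle_type:
  assumes "w permutes {1..n}"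
  shows "0 \<notin># cycle_type n w"
proof
  assume "0 \<in># cycle_type n w"
  then obtain Q where Q: "Q \<in> Orbits.orbit w ` {1..n}" "card Q = 0"
    unfolding cycle_type_def by (metis (no_types, lifting) finite_atLeastAtMost finite_imageI
        finite_set_mset_mset_set imageE set_image_mset)
  then show False
    using finite_cycle(2)[OF assms _ Q(1)] by simp
qed

text \<open>Indexing by cycles instead of lengths keeps cycles of equal length apart, so that each
  can later carry its own value.\<close>

lemma prod_cycle_type:
  "(\<Prod>m\<in>#cycle_type n w. g m) = (\<Prod>Q\<in>Orbits.orbit w ` {1..n}. g (card Q))"
  unfolding cycle_type_def prod_unfold_prod_mset by (simp add: image_mset.compositionality o_def)

lemma sum_constant_mset: "(\<Sum>i\<in>A. X) = repeat_mset (card A) X"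
  by (induction A rule: infinite_finite_induct) simp_all

lemma orbit_invariant:
  assumes "f \<circ> w = f" "j \<in> Orbits.orbit w i"
  shows "f j = f i"
  using assms(2) by induction (use assms(1) in \<open>auto simp: fun_eq_iff\<close>)

text \<open>A function fixed by \<open>w\<close> is a free choice of one value for every cycle of \<open>w\<close>.\<close>

lemma gen_series_cycles:
  assumes g: "gen_series g J wt" and w: "w permutes S" and S: "finite S"
  shows "gen_series (\<Prod>Q\<in>Orbits.orbit w ` S. adams (card Q) g)
    {f \<in> S \<rightarrow>\<^sub>E J. f \<circ> w = f} (\<lambda>f. \<Sum>i\<in>S. wt (f i))"
proof (rule gen_series_bij)
  let ?orb = "Orbits.orbit w"
  let ?Q = "?orb ` S"
  show "gen_series (\<Prod>Q\<in>?Q. adams (card Q) g) (PiE ?Q (\<lambda>_. J))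
      (\<lambda>F. \<Sum>Q\<in>?Q. repeat_mset (card Q) (wt (F Q)))"
  proof (rule gen_series_prod[where wt = "\<lambda>Q j. repeat_mset (card Q) (wt j)"])
    show "gen_series (adams (card Q) g) J (\<lambda>j. repeat_mset (card Q) (wt j))" if "Q \<in> ?Q" for Q
      using g finite_cycle(2)[OF w S that] by (intro gen_series_adams) auto
  qed (simp add: S)
  \<comment> \<open>\<open>?h\<close> reads off \<open>f\<close> at some point of each cycle, which
    is harmless since \<open>f\<close> is constant there; \<open>?k\<close> spreads the chosen
    values back over the cycles.\<close>
  let ?h = "\<lambda>f. \<lambda>Q\<in>?Q. f (SOME i. i \<in> Q)"
  let ?k = "\<lambda>F. \<lambda>i\<in>S. F (?orb i)"
  have some: "(SOME i. i \<in> Q) \<in> Q" "Q \<subseteq> S" if "Q \<in> ?Q" for Q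
    using that permutes_orbit_subset[OF w] orbit_nonempty some_in_eq by fast+
  have perm: "permutation w"
    using w S permutation_permutes by blast
  have step: "?orb (w i) = ?orb i" for i
    using perm by (rule permutation_orbit_step)
  have const: "f (SOME i. i \<in> ?orb i') = f i'" if "f \<circ> w = f" "i' \<in> S" for f i'
    using orbit_invariant[OF that(1)] some(1)[of "?orb i'"] that(2) by blast
  show "bij_betw ?h {f \<in> S \<rightarrow>\<^sub>E J. f \<circ> w = f} (PiE ?Q (\<lambda>_. J))"
  proof (rule bij_betw_byWitness[where f' = ?k])
    show "\<forall>f\<in>{f \<in> S \<rightarrow>\<^sub>E J. f \<circ> w = f}. ?k (?h f) = f"
    proof
      fix f assume f: "f \<in> {f \<in> S \<rightarrow>\<^sub>E J. f \<circ> w = f}"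
      show "?k (?h f) = f"
      proof (rule extensionalityI[of _ "S"])
        show "f \<in> extensional S"
          using f by (auto simp: PiE_def)
        show "?k (?h f) i = f i" if "i \<in> S" for i
          using that const[of f i] f by simp
      qed simp
    qed
    show "\<forall>F\<in>PiE ?Q (\<lambda>_. J). ?h (?k F) = F"
    proof
      fix F assume F: "F \<in> PiE ?Q (\<lambda>_. J)"
      show "?h (?k F) = F"
      proof (rule extensionalityI[of _ ?Q])
        show "F \<in> extensional ?Q"
          using F by (auto simp: PiE_def)
        fix Q assume Q: "Q \<in> ?Q"
        then have "?orb (SOME i. i \<in> Q) = Q"
          using some[OF Q] orbit_eq_iff_permutes[OF w S] by blast
        then show "?h (?k F) Q = F Q"
          using Q some[OF Q] by auto
      qed auto
    qed
    show "?h ` {f \<in> S \<rightarrow>\<^sub>E J. f \<circ> w = f} \<subseteq> PiE ?Q (\<lambda>_. J)"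
    proof
      fix F assume "F \<in> ?h ` {f \<in> S \<rightarrow>\<^sub>E J. f \<circ> w = f}"
      then obtain f where f: "f \<in> S \<rightarrow>\<^sub>E J" "F = ?h f"
        by blast
      have "f (SOME i. i \<in> Q) \<in> J" if "Q \<in> ?Q" for Q
        using f(1) some[OF that] by (auto simp: PiE_iff)
      then show "F \<in> PiE ?Q (\<lambda>_. J)"
        unfolding f(2) by (auto simp: PiE_iff)
    qed
    show "?k ` PiE ?Q (\<lambda>_. J) \<subseteq> {f \<in> S \<rightarrow>\<^sub>E J. f \<circ> w = f}"
    proof
      fix f assume "f \<in> ?k ` PiE ?Q (\<lambda>_. J)"
      then obtain F where F: "F \<in> PiE ?Q (\<lambda>_. J)" "f = ?k F"
        by blast
      have "f (w i) = f i" for i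
        using permutes_in_image[OF w, of i] by (simp add: F(2) step)
      then show "f \<in> {f \<in> S \<rightarrow>\<^sub>E J. f \<circ> w = f}"
        unfolding F(2) using F(1) by (auto simp: fun_eq_iff PiE_iff F(2))
    qed
  qed
  fix f assume f: "f \<in> {f \<in> S \<rightarrow>\<^sub>E J. f \<circ> w = f}"
  \<comment> \<open>All \<open>card Q\<close> points of a cycle contribute the same weight, which is
    where \<open>repeat_mset (card Q)\<close>, and hence \<open>adams (card Q)\<close>, comes
    from.\<close>
  have "(\<Sum>i\<in>S. wt (f i)) = (\<Sum>Q\<in>?Q. \<Sum>i\<in>{i\<in>S. ?orb i = Q}. wt (f i))"
    using S by (rule sum.image_gen)
  also have "\<dots> = (\<Sum>Q\<in>?Q. repeat_mset (card Q) (wt (?h f Q)))"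
  proof (rule sum.cong[OF refl])
    fix Q assume Q: "Q \<in> ?Q"
    have "(\<Sum>i\<in>{i\<in>S. ?orb i = Q}. wt (f i)) = (\<Sum>i\<in>Q. wt (?h f Q))"
    proof (rule sum.cong)
      show "{i\<in>S. ?orb i = Q} = Q"
        using cycle_fibre[OF w S Q] by simp
      fix i assume "i \<in> Q"
      then have "i \<in> S" "?orb i = Q"
        using cycle_fibre[OF w S Q] by auto
      then show "wt (f i) = wt (?h f Q)"
        using const[of f i] f Q by auto
    qed
    then show "(\<Sum>i\<in>{i\<in>S. ?orb i = Q}. wt (f i)) = repeat_mset (card Q) (wt (?h f Q))"
      by (simp add: sum_constant_mset)
  qed
  finally show "(\<Sum>i\<in>S. wt (f i)) = (\<Sum>Q\<in>?Q. repeat_mset (card Q) (wt (?h f Q)))" .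
qed

lemma gen_series_cycle_type:
  assumes "gen_series g J wt" "w permutes {1..n}"
  shows "gen_series (\<Prod>m\<in>#cycle_type n w. adams m g)
    {f \<in> {1..n} \<rightarrow>\<^sub>E J. f \<circ> w = f} (\<lambda>f. \<Sum>i\<in>{1..n}. wt (f i))"
  unfolding prod_cycle_type using assms by (rule gen_series_cycles) simp

text \<open>No part of a cycle type is 0, so each factor \<open>power_sum m\<close> equals
  \<open>adams m (power_sum 1)\<close>. This reduces the claim to the preceding count, with a single
  variable as the weight of each value.\<close>

lemma gen_series_power_sum_part_cycle_type:
  assumes w: "w permutes {1..n}"
  shows "gen_series (power_sum_part (cycle_type n w) :: 'a::comm_ring_1 symfun)
    {f \<in> {1..n} \<rightarrow>\<^sub>E UNIV. f \<circ> w = f} (\<lambda>f. \<Sum>i\<in>{1..n}. {#f i#})"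
proof -
  have "(power_sum_part (cycle_type n w) :: 'a symfun) = (\<Prod>m\<in>#cycle_type n w. adams m (power_sum 1))"
    unfolding power_sum_part_def using zero_notin_cycle_type[OF w]
    by (intro arg_cong[where f = prod_mset] image_mset_cong) (metis adams_power_sum gr0I mult.right_neutral zero_less_one)
  moreover have "gen_series (power_sum 1 :: 'a symfun) UNIV (\<lambda>i. {#i#})"
    using gen_series_power_sum[of 1] by simp
  ultimately show ?thesis
    using gen_series_cycle_type[OF _ w, of "power_sum 1" UNIV "\<lambda>i. {#i#}"] by simp
qed

section \<open>Conjugacy\<close>

text \<open>Used to pair the cycles of two permutations so that paired cycles have equal length. The
  induction matches one \<open>a\<close> with some \<open>b0\<close> of the same value and removes
  both.\<close>

lemma image_mset_eq_imp_bij_betw: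
  assumes "finite A" "finite B" "image_mset f (mset_set A) = image_mset g (mset_set B)"
  shows "\<exists>b. bij_betw b A B \<and> (\<forall>a\<in>A. g (b a) = f a)"
  using assms
proof (induction A arbitrary: B rule: finite_induct)
  case empty
  then have "B = {}"
    by (simp add: mset_set_empty_iff)
  then show ?case
    by (auto simp: bij_betw_def)
next
  case (insert a A)
  have "f a \<in># image_mset g (mset_set B)"
    unfolding insert.prems(2)[symmetric] using insert.hyps by simp
  then obtain b0 where b0: "b0 \<in> B" "g b0 = f a"
    using insert.prems(1) by auto
  have "mset_set B = add_mset b0 (mset_set (B - {b0}))"
    using b0 insert.prems(1) by (metis finite_Diff insert_Diff_single insert_absorb mset_set.insert_remove)
  then have "image_mset f (mset_set A) = image_mset g (mset_set (B - {b0}))"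
    using insert.prems(2) insert.hyps b0 by simp
  then obtain b where b: "bij_betw b A (B - {b0})" "\<forall>a\<in>A. g (b a) = f a"
    using insert.IH[of "B - {b0}"] insert.prems(1) by auto
  have "bij_betw (b(a := b0)) (A \<union> {a}) ((B - {b0}) \<union> {b0})"
    using b insert.hyps notIn_Un_bij_betw[of a A "b(a := b0)" "B - {b0}"]
    by (metis (no_types, lifting) Diff_iff bij_betw_cong fun_upd_other fun_upd_same singletonI)
  then have "bij_betw (b(a := b0)) (insert a A) B"
    using b0 by (simp add: insert_absorb)
  moreover have "\<forall>x\<in>insert a A. g ((b(a := b0)) x) = f x"
    using b(2) b0 insert.hyps by auto
  ultimately show ?case
    by blast
qed

lemma funpow_orbit_bij_betw:
  assumes "permutation v"
  shows "bij_betw (\<lambda>j. (v ^^ j) x) {0..<card (Orbits.orbit v x)} (Orbits.orbit v x)"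
    and "(v ^^ card (Orbits.orbit v x)) x = x"
proof -
  have self: "x \<in> Orbits.orbit v x"
    using assms by (rule permutation_self_in_orbit)
  let ?D = "funpow_dist1 v x x"
  have b: "bij_betw (\<lambda>j. (v ^^ j) x) {0..<?D} (Orbits.orbit v x)"
    using inj_on_funpow_dist1[OF self] orbit_conv_funpow_dist1[OF self] by (simp add: bij_betw_def)
  have c: "card (Orbits.orbit v x) = ?D"
    using bij_betw_same_card[OF b] by simp
  show "bij_betw (\<lambda>j. (v ^^ j) x) {0..<card (Orbits.orbit v x)} (Orbits.orbit v x)"
    unfolding c by (rule b)
  show "(v ^^ card (Orbits.orbit v x)) x = x"
    unfolding c by (rule funpow_dist1_prop[OF self])
qed

text \<open>Walk around both cycles simultaneously: \<open>h\<close> sends the \<open>j\<close>-th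
  iterate of \<open>x\<close> to the \<open>j\<close>-th iterate of \<open>y\<close>. Intertwining
  is immediate except at the last step, where equal lengths make both walks close up
  together.\<close>

lemma orbits_conjugate:
  assumes "permutation v" "permutation w"
    and card: "card (Orbits.orbit v x) = card (Orbits.orbit w y)"
  shows "\<exists>h. bij_betw h (Orbits.orbit v x) (Orbits.orbit w y) \<and> (\<forall>i\<in>Orbits.orbit v x. h (v i) = w (h i))"
proof -
  let ?m = "card (Orbits.orbit v x)"
  let ?a = "\<lambda>j. (v ^^ j) x" and ?b = "\<lambda>j. (w ^^ j) y"
  note a = funpow_orbit_bij_betw[OF assms(1), of x]
  note b = funpow_orbit_bij_betw[OF assms(2), of y, folded card]
  define h where "h = ?b \<circ> the_inv_into {0..<?m} ?a"
  have "bij_betw h (Orbits.orbit v x) (Orbits.orbit w y)"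
    unfolding h_def using a(1) b(1) by (intro bij_betw_trans[OF bij_betw_the_inv_into])
  have h: "h (?a j) = ?b j" if "j < ?m" for j
    using the_inv_into_f_f[of ?a "{0..<?m}" j] that a(1) unfolding h_def bij_betw_def by simp
  have "h (v i) = w (h i)" if "i \<in> Orbits.orbit v x" for i
  proof -
    have "i \<in> ?a ` {0..<?m}"
      using that a(1) by (simp add: bij_betw_def)
    then obtain j where j: "j < ?m" "i = ?a j"
      by auto
    have vi: "v i = ?a (Suc j)"
      using j by simp
    show ?thesis
    proof (cases "Suc j < ?m")
      case True
      then have "h (v i) = ?b (Suc j)"
        unfolding vi by (rule h)
      then show ?thesis
        using h[OF j(1)] j(2) by simp
    next
      case False
      then have m: "?m = Suc j"
        using j by simp
      then have "h (v i) = h (?a 0)"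
        using a(2) vi by simp
      also have "\<dots> = ?b 0"
        using j(1) by (intro h) auto
      also have "\<dots> = ?b (Suc j)"
        using b(2) m by simp
      finally show ?thesis
        using h[OF j(1)] j(2) by simp
    qed
  qed
  with \<open>bij_betw h _ _\<close> show ?thesis
    by blast
qed

text \<open>Cycles are paired by length and each pair is intertwined by a bijection;
  \<open>u\<close> is glued from these bijections. It is injective because the cycle of
  \<open>w\<close> through \<open>u i\<close> reveals the cycle of \<open>v\<close> through
  \<open>i\<close>.\<close>

lemma cycles_eq_imp_conjugate:
  assumes v: "v permutes S" and w: "w permutes S" and S: "finite S"
    and "image_mset card (mset_set (Orbits.orbit v ` S)) = image_mset card (mset_set (Orbits.orbit w ` S))"
  shows "\<exists>u. u permutes S \<and> w = u \<circ> v \<circ> inv' u"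
proof -
  let ?V = "Orbits.orbit v ` S" and ?W = "Orbits.orbit w ` S"
  have pv: "permutation v" and pw: "permutation w"
    using v w S permutation_permutes by blast+
  obtain b where b: "bij_betw b ?V ?W" "\<forall>Q\<in>?V. card (b Q) = card Q"
    using image_mset_eq_imp_bij_betw[of ?V ?W card card] S assms(4) by auto
  have "\<forall>Q\<in>?V. \<exists>h. bij_betw h Q (b Q) \<and> (\<forall>i\<in>Q. h (v i) = w (h i))"
  proof
    fix Q assume Q: "Q \<in> ?V"
    then obtain x where x: "Q = Orbits.orbit v x"
      by auto
    obtain y where y: "b Q = Orbits.orbit w y"
      using bij_betwE[OF b(1)] Q by blast
    show "\<exists>h. bij_betw h Q (b Q) \<and> (\<forall>i\<in>Q. h (v i) = w (h i))"
      using orbits_conjugate[OF pv pw, of x y] b(2) Q unfolding x[symmetric] y[symmetric] by auto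
  qed
  then obtain h where h: "\<And>Q. Q \<in> ?V \<Longrightarrow> bij_betw (h Q) Q (b Q)"
      "\<And>Q i. Q \<in> ?V \<Longrightarrow> i \<in> Q \<Longrightarrow> h Q (v i) = w (h Q i)"
    by (metis (no_types, lifting))
  define u where "u = (\<lambda>i. if i \<in> S then h (Orbits.orbit v i) i else i)"
  have self: "i \<in> Orbits.orbit v i" for i
    using pv by (rule permutation_self_in_orbit)
  have ub: "u i \<in> b (Orbits.orbit v i)" if "i \<in> S" for i
    using h(1)[of "Orbits.orbit v i"] that self[of i] by (auto simp: u_def bij_betw_def)
  have bW: "b (Orbits.orbit v i) \<in> ?W" if "i \<in> S" for i
    using b(1) that by (auto simp: bij_betw_def)
  have uS: "u i \<in> S" if "i \<in> S" for i
    using ub[OF that] bW[OF that] permutes_orbit_subset[OF w] by blast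
  have "inj_on u S"
  proof (rule inj_onI)
    fix i j assume ij: "i \<in> S" "j \<in> S" "u i = u j"
    have "Orbits.orbit w (u i) = b (Orbits.orbit v i)" "Orbits.orbit w (u i) = b (Orbits.orbit v j)"
      using orbit_eq_iff_permutes[OF w S uS[OF ij(1)] bW[OF ij(1)]] ub[OF ij(1)]
        orbit_eq_iff_permutes[OF w S uS[OF ij(1)] bW[OF ij(2)]] ub[OF ij(2)] ij(3) by simp_all
    then have "Orbits.orbit v i = Orbits.orbit v j"
      using b(1) ij by (auto simp: bij_betw_def inj_on_def)
    then show "i = j"
      using ij h(1)[of "Orbits.orbit v i"] self[of i] self[of j] by (auto simp: u_def bij_betw_def inj_on_def)
  qed
  then have "bij_betw u S S"
    using endo_inj_surj[OF S] uS by (auto simp: bij_betw_def)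
  then have u: "u permutes S"
    by (rule bij_imp_permutes) (simp add: u_def)
  have "u (v i) = w (u i)" for i
  proof (cases "i \<in> S")
    case True
    then show ?thesis
      using h(2)[of "Orbits.orbit v i" i] self[of i] permutation_orbit_step[OF pv, of i]
        permutes_in_image[OF v, of i] by (simp add: u_def)
  next
    case False
    then have "v i = i" "u i = i" "w i = i"
      using v w u by (auto dest: permutes_not_in)
    then show ?thesis by simp
  qed
  then have "u \<circ> v = w \<circ> u"
    by (simp add: fun_eq_iff)
  then have "u \<circ> v \<circ> inv' u = w"
    using permutes_inv_o(1)[OF u] by (simp add: comp_assoc)
  with u show ?thesis
    by blast
qed

lemma finite_sym_group: "finite (carrier (sym_group n))"
  by (simp add: sym_group_def finite_permutations)

lemma card_sym_group: "card (carrier (sym_group n)) = fact n"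
  by (simp add: sym_group_def card_permutations)

lemma class_function_cycle_type:
  assumes "\<phi> \<in> class_functions (sym_group n)" "v permutes {1..n}" "w permutes {1..n}"
    "cycle_type n v = cycle_type n w"
  shows "\<phi> v = \<phi> w"
proof -
  obtain u where u: "u permutes {1..n}" "w = u \<circ> v \<circ> inv' u"
    using cycles_eq_imp_conjugate[OF assms(2,3)] assms(4) unfolding cycle_type_def by blast
  then have "\<phi> (u \<otimes>\<^bsub>sym_group n\<^esub> v \<otimes>\<^bsub>sym_group n\<^esub> inv\<^bsub>sym_group n\<^esub> u) = \<phi> v"
    using assms(1,2) by (auto simp: class_functions_def sym_group_carrier)
  then show ?thesis
    using u by (simp add: sym_group_mult sym_group_carrier)
qed

text \<open>By linear independence, every coefficient \<open>c \<mu>\<close> in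
  \<open>fact n\<close> times the difference of the characteristics vanishes. It sums \<phi> -
  \<psi> over the permutations of cycle type \<mu>, on which class functions are constant, so for
  \<mu> the type of \<open>v\<close> it is a positive multiple of the difference at
  \<open>v\<close>.\<close>

lemma inj_on_frobenius_ch: "inj_on (frobenius_ch n) (class_functions (sym_group n))"
proof (rule inj_onI)
  fix \<phi> \<psi> assume \<phi>: "\<phi> \<in> class_functions (sym_group n)" and \<psi>: "\<psi> \<in> class_functions (sym_group n)"
    and eq: "frobenius_ch n \<phi> = frobenius_ch n \<psi>"
  let ?G = "carrier (sym_group n)" and ?ct = "cycle_type n"
  define c where "c = (\<lambda>\<mu>. \<Sum>w | w \<in> ?G \<and> ?ct w = \<mu>. \<phi> w - \<psi> w)"
  have "scale_sf (fact n) (frobenius_ch n \<phi> - frobenius_ch n \<psi>) = 0"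
    by (rule symfun_eqI) (simp add: eq coeff_sf_simps)
  moreover have "scale_sf (fact n) (frobenius_ch n \<phi> - frobenius_ch n \<psi>) =
      (\<Sum>w\<in>?G. scale_sf (\<phi> w - \<psi> w) (power_sum_part (?ct w)))"
    unfolding frobenius_ch_def minus_symfun_def
    by (rule symfun_eqI) (simp add: distrib_left sum_negf coeff_sf_simps left_diff_distrib sum_subtractf right_diff_distrib del: add_uminus_conv_diff)
  moreover have "\<dots> = (\<Sum>\<mu>\<in>?ct ` ?G. \<Sum>w | w \<in> ?G \<and> ?ct w = \<mu>. scale_sf (\<phi> w - \<psi> w) (power_sum_part (?ct w)))"
    by (rule sum.image_gen) (rule finite_sym_group)
  moreover have "\<dots> = (\<Sum>\<mu>\<in>?ct ` ?G. scale_sf (c \<mu>) (power_sum_part \<mu>))"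
    unfolding scale_sf_sum_left c_def by (intro sum.cong) auto
  ultimately have zero: "(\<Sum>\<mu>\<in>?ct ` ?G. scale_sf (c \<mu>) (power_sum_part \<mu>)) = 0"
    by simp
  have "\<phi> v = \<psi> v" if v: "v \<in> ?G" for v
  proof -
    have "c (?ct v) = 0"
      by (rule power_sum_part_independent[where c = c, OF _ _ zero])
        (use v zero_notin_cycle_type in \<open>auto simp: finite_sym_group sym_group_carrier\<close>)
    moreover have "c (?ct v) = (\<Sum>w | w \<in> ?G \<and> ?ct w = ?ct v. \<phi> v - \<psi> v)"
      unfolding c_def
    proof (rule sum.cong[OF refl])
      fix w assume "w \<in> {w. w \<in> ?G \<and> ?ct w = ?ct v}"
      then have "\<phi> w = \<phi> v" "\<psi> w = \<psi> v"
        using v class_function_cycle_type[OF \<phi>, of w v] class_function_cycle_type[OF \<psi>, of w v]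
        by (simp_all add: sym_group_carrier)
      then show "\<phi> w - \<psi> w = \<phi> v - \<psi> v"
        by simp
    qed
    moreover have "card {w. w \<in> ?G \<and> ?ct w = ?ct v} \<noteq> 0"
      using v finite_sym_group[of n] by auto
    ultimately show ?thesis
      by simp
  qed
  then show "\<phi> = \<psi>"
    using \<phi> \<psi> unfolding class_functions_def by (auto intro: extensionalityI)
qed

section \<open>Counting orbits\<close>

text \<open>Here \<open>act\<close> may live on a larger type than \<open>X\<close>, as
  \<open>relabel\<close> does, so the same function also acts on invariant subsets. Restricting it
  to \<open>X\<close> recovers the extensional form required by \<open>group_action\<close>, which
  makes Burnside's lemma available.\<close>

locale set_action = group G for G :: "('g, 'm) monoid_scheme" (structure) +
  fixes act :: "'g \<Rightarrow> 'x \<Rightarrow> 'x" and X :: "'x set"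
  assumes act_closed: "g \<in> carrier G \<Longrightarrow> x \<in> X \<Longrightarrow> act g x \<in> X"
    and act_one: "x \<in> X \<Longrightarrow> act \<one> x = x"
    and act_mult: "g \<in> carrier G \<Longrightarrow> h \<in> carrier G \<Longrightarrow> x \<in> X \<Longrightarrow> act (g \<otimes> h) x = act g (act h x)"
begin

abbreviation orb :: "'x \<Rightarrow> 'x set" where
  "orb \<equiv> Group_Action.orbit G act"

lemma act_inv: "g \<in> carrier G \<Longrightarrow> x \<in> X \<Longrightarrow> act (inv g) (act g x) = x"
  using act_mult[of "inv g" g x] by (simp add: act_one)

lemma act_inv': "g \<in> carrier G \<Longrightarrow> x \<in> X \<Longrightarrow> act g (act (inv g) x) = x"
  using act_mult[of g "inv g" x] by (simp add: act_one)

lemma bij_betw_act: "g \<in> carrier G \<Longrightarrow> bij_betw (act g) X X"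
  by (rule bij_betw_byWitness[where f' = "act (inv g)"]) (auto simp: act_inv act_inv' act_closed)

lemma group_action: "group_action G X (\<lambda>g. \<lambda>x\<in>X. act g x)"
proof -
  have bij: "(\<lambda>x\<in>X. act g x) \<in> Bij X" if "g \<in> carrier G" for g
    using bij_betw_act[OF that] by (simp add: Bij_def cong: bij_betw_cong)
  then have "(\<lambda>x\<in>X. act (g \<otimes> h) x) =
      (\<lambda>x\<in>X. act g x) \<otimes>\<^bsub>BijGroup X\<^esub> (\<lambda>x\<in>X. act h x)" if "g \<in> carrier G" "h \<in> carrier G" for g h
    using that by (auto simp: BijGroup_def compose_def act_mult act_closed fun_eq_iff)
  then have "(\<lambda>g. \<lambda>x\<in>X. act g x) \<in> hom G (BijGroup X)"
    using bij by (intro homI) (auto simp: BijGroup_def)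
  then show ?thesis
    unfolding group_action_def by (intro group_hom.intro group_hom_axioms.intro group_BijGroup) (rule is_group)
qed

lemma orbit_restrict: "x \<in> X \<Longrightarrow> Group_Action.orbit G (\<lambda>g. \<lambda>x\<in>X. act g x) x = orb x"
  by (simp add: Group_Action.orbit_def)

lemma burnside_count:
  assumes "finite (carrier G)" "finite X"
  shows "(\<Sum>g\<in>carrier G. card {x\<in>X. act g x = x}) = card (orb ` X) * card (carrier G)"
proof -
  have "Group_Action.orbits G X (\<lambda>g. \<lambda>x\<in>X. act g x) = orb ` X"
    using orbit_restrict by (auto simp: Group_Action.orbits_def)
  moreover have "invariants X (\<lambda>g. \<lambda>x\<in>X. act g x) g = {x\<in>X. act g x = x}" for g
    by (auto simp: invariants_def)
  ultimately show ?thesis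
    using group_action.burnside[OF group_action assms] by (simp only: order_def)
qed

lemma orb_self: "x \<in> X \<Longrightarrow> x \<in> orb x"
  unfolding Group_Action.orbit_def using act_one one_closed by force

lemma orb_subset: "x \<in> X \<Longrightarrow> orb x \<subseteq> X"
  unfolding Group_Action.orbit_def using act_closed by blast

lemma orb_act: "g \<in> carrier G \<Longrightarrow> x \<in> X \<Longrightarrow> orb (act g x) = orb x"
proof
  assume g: "g \<in> carrier G" "x \<in> X"
  then show "orb (act g x) \<subseteq> orb x"
    unfolding Group_Action.orbit_def by clarify (metis act_mult m_closed)
  show "orb x \<subseteq> orb (act g x)"
  proof
    fix y assume "y \<in> orb x"
    then obtain h where h: "h \<in> carrier G" "y = act h x"
      by (auto simp: Group_Action.orbit_def)
    then have "y = act (h \<otimes> inv g) (act g x)"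
      using g by (simp add: act_mult act_closed act_inv)
    then show "y \<in> orb (act g x)"
      using g h by (auto simp: Group_Action.orbit_def)
  qed
qed

lemma orb_eq_iff:
  assumes "x \<in> X" "y \<in> X"
  shows "orb x = orb y \<longleftrightarrow> (\<exists>g\<in>carrier G. act g x = y)"
proof
  assume "orb x = orb y"
  then have "y \<in> orb x"
    using orb_self[OF assms(2)] by simp
  then show "\<exists>g\<in>carrier G. act g x = y"
    by (auto simp: Group_Action.orbit_def)
next
  assume "\<exists>g\<in>carrier G. act g x = y"
  then show "orb x = orb y"
    using orb_act[OF _ assms(1)] by auto
qed

lemma orb_of_mem: "x \<in> X \<Longrightarrow> y \<in> orb x \<Longrightarrow> orb y = orb x"
proof -
  assume x: "x \<in> X" "y \<in> orb x"
  then obtain g where "g \<in> carrier G" "y = act g x"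
    unfolding Group_Action.orbit_def by blast
  with x show ?thesis
    by (simp only: orb_act)
qed

lemma orb_some:
  assumes "x \<in> X"
  shows "(SOME y. y \<in> orb x) \<in> X" "orb (SOME y. y \<in> orb x) = orb x" "(SOME y. y \<in> orb x) \<in> orb x"
proof -
  show s: "(SOME y. y \<in> orb x) \<in> orb x"
    using orb_self[OF assms] by (rule someI[of "\<lambda>y. y \<in> orb x"])
  show "(SOME y. y \<in> orb x) \<in> X"
    using s orb_subset[OF assms] by blast
  show "orb (SOME y. y \<in> orb x) = orb x"
    using assms s by (rule orb_of_mem)
qed

text \<open>Weights of orbits are written with a representative picked by \<open>SOME\<close>;
  invariance makes the pick irrelevant.\<close>

lemma weight_some:
  assumes "\<And>g x. g \<in> carrier G \<Longrightarrow> x \<in> X \<Longrightarrow> wt (act g x) = wt x" "x \<in> X"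
  shows "wt (SOME y. y \<in> orb x) = wt x"
proof -
  obtain g where "g \<in> carrier G" "(SOME y. y \<in> orb x) = act g x"
    using orb_some(3)[OF assms(2)] unfolding Group_Action.orbit_def by blast
  then show ?thesis
    using assms by metis
qed

text \<open>Burnside's lemma, applied to the elements of each weight separately: \<open>X\<close> may be infinite.\<close>

lemma gen_series_orbits:
  fixes f :: "'g \<Rightarrow> 'a::field_char_0 symfun"
  assumes fin: "finite (carrier G)"
    and wt: "\<And>g x. g \<in> carrier G \<Longrightarrow> x \<in> X \<Longrightarrow> wt (act g x) = wt x"
    and f: "\<And>g. g \<in> carrier G \<Longrightarrow> gen_series (f g) {x\<in>X. act g x = x} wt"
  shows "gen_series (scale_sf (1 / of_nat (card (carrier G))) (\<Sum>g\<in>carrier G. f g)) (orb ` X)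
    (\<lambda>\<Omega>. wt (SOME x. x \<in> \<Omega>))"
  unfolding gen_series_def
proof
  fix M
  let ?X = "{x\<in>X. wt x = M}"
  interpret level: set_action G act ?X
  proof
    show "act g x \<in> ?X" if "g \<in> carrier G" "x \<in> ?X" for g x
      using that act_closed wt by simp
  qed (simp_all add: act_one act_mult)
  \<comment> \<open>The level set is finite because the identity fixes all of it, and the fibres of
    the series \<open>f \<one>\<close> are finite.\<close>
  have "{x \<in> {x\<in>X. act \<one> x = x}. wt x = M} = ?X"
    by (auto simp: act_one)
  then have finX: "finite ?X"
    using gen_series_finite[OF f[OF one_closed], of M] by (simp only:)
  have orbs: "{\<Omega> \<in> orb ` X. wt (SOME x. x \<in> \<Omega>) = M} = orb ` ?X"
    using weight_some[of wt, OF wt] by auto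
  have "coeff_sf (scale_sf (1 / of_nat (card (carrier G))) (\<Sum>g\<in>carrier G. f g)) M =
      (\<Sum>g\<in>carrier G. of_nat (card {x\<in>?X. act g x = x})) / of_nat (card (carrier G))"
    unfolding coeff_sf_simps using gen_series_coeff[OF f, of _ M]
    by (simp add: conj_ac conj_commute cong: sum.cong)
  also have "\<dots> = of_nat (card (orb ` ?X))"
    unfolding of_nat_sum[symmetric] level.burnside_count[OF fin finX]
    using fin one_closed by (auto simp: card_eq_0_iff)
  finally show "finite {\<Omega> \<in> orb ` X. wt (SOME x. x \<in> \<Omega>) = M} \<and>
      coeff_sf (scale_sf (1 / of_nat (card (carrier G))) (\<Sum>g\<in>carrier G. f g)) M =
      of_nat (card {\<Omega> \<in> orb ` X. wt (SOME x. x \<in> \<Omega>) = M})"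
    unfolding orbs using finX by simp
qed

end

text \<open>A relation \<open>R\<close> takes the place of a map because the correspondence will
  depend on a choice of chart. One direction of \<open>compat\<close> makes the induced map on
  orbits well defined, the other makes it injective; the two halves of \<open>total\<close> give
  existence and surjectivity.\<close>

lemma orbit_bijection:
  fixes R :: "'x \<Rightarrow> 'y \<Rightarrow> bool"
  assumes "set_action G a X" "set_action H b Y"
    and total: "\<And>x. x \<in> X \<Longrightarrow> \<exists>y\<in>Y. R x y" "\<And>y. y \<in> Y \<Longrightarrow> \<exists>x\<in>X. R x y"
    and compat: "\<And>x x' y y'. x \<in> X \<Longrightarrow> x' \<in> X \<Longrightarrow> y \<in> Y \<Longrightarrow> y' \<in> Y \<Longrightarrow> R x y \<Longrightarrow> R x' y' \<Longrightarrow>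
      (\<exists>g\<in>carrier G. a g x = x') \<longleftrightarrow> (\<exists>h\<in>carrier H. b h y = y')"
    and wt: "\<And>x y. x \<in> X \<Longrightarrow> y \<in> Y \<Longrightarrow> R x y \<Longrightarrow> u x = v y"
    and v: "\<And>h y. h \<in> carrier H \<Longrightarrow> y \<in> Y \<Longrightarrow> v (b h y) = v y"
  shows "\<exists>F. bij_betw F (Group_Action.orbit G a ` X) (Group_Action.orbit H b ` Y) \<and>
    (\<forall>\<Omega>\<in>Group_Action.orbit G a ` X. u (SOME x. x \<in> \<Omega>) = v (SOME y. y \<in> F \<Omega>))"
proof -
  interpret A: set_action G a X by fact
  interpret B: set_action H b Y by fact
  have compat': "A.orb x = A.orb x' \<longleftrightarrow> B.orb y = B.orb y'"
    if "x \<in> X" "x' \<in> X" "y \<in> Y" "y' \<in> Y" "R x y" "R x' y'" for x x' y y'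
    using compat[OF that] A.orb_eq_iff B.orb_eq_iff that by simp
  obtain h where h: "\<And>x. x \<in> X \<Longrightarrow> h x \<in> Y" "\<And>x. x \<in> X \<Longrightarrow> R x (h x)"
    using total(1) by metis
  define F where "F = (\<lambda>\<Omega>. B.orb (h (SOME x. x \<in> \<Omega>)))"
  have F: "F (A.orb x) = B.orb y" if "x \<in> X" "y \<in> Y" "R x y" for x y
    unfolding F_def
    using compat'[OF A.orb_some(1)[OF that(1)] that(1) h(1)[OF A.orb_some(1)[OF that(1)]] that(2)
        h(2)[OF A.orb_some(1)[OF that(1)]] that(3)] A.orb_some(2)[OF that(1)] by simp
  have "inj_on F (A.orb ` X)"
    by (rule inj_onI) (use F h compat' in \<open>smt (verit) imageE\<close>)
  moreover have "F ` (A.orb ` X) = B.orb ` Y"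
  proof
    show "F ` (A.orb ` X) \<subseteq> B.orb ` Y"
    proof clarify
      fix x assume "x \<in> X"
      then show "F (A.orb x) \<in> B.orb ` Y"
        using F[of x "h x"] h by simp
    qed
    show "B.orb ` Y \<subseteq> F ` (A.orb ` X)"
    proof clarify
      fix y assume "y \<in> Y"
      then obtain x where "x \<in> X" "R x y"
        using total(2) by blast
      then show "B.orb y \<in> F ` (A.orb ` X)"
        using F[of x y] \<open>y \<in> Y\<close> by (metis imageI)
    qed
  qed
  moreover have "u (SOME x. x \<in> \<Omega>) = v (SOME y. y \<in> F \<Omega>)" if "\<Omega> \<in> A.orb ` X" for \<Omega>
  proof -
    define x where "x = (SOME x. x \<in> \<Omega>)"
    have x: "x \<in> X"
      using that A.orb_some(1) by (auto simp: x_def)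
    have "u x = v (h x)"
      using wt x h by blast
    also have "\<dots> = v (SOME y. y \<in> B.orb (h x))"
      using B.weight_some[of v, OF v h(1)[OF x]] by simp
    finally show ?thesis
      by (simp add: F_def x_def)
  qed
  ultimately show ?thesis
    by (auto simp: bij_betw_def)
qed

lemma gen_series_unique: "gen_series f J wt \<Longrightarrow> gen_series g J wt \<Longrightarrow> f = g"
  by (rule symfun_eqI) (simp add: gen_series_coeff)

section \<open>Frobenius characteristics of permutation characters\<close>

lemma set_action_functions: "set_action (sym_group n) (\<lambda>w f. f \<circ> inv' w) ({1..n} \<rightarrow>\<^sub>E J)"
proof -
  interpret group "sym_group n"
    by (rule sym_group_is_group)
  show ?thesis
  proof
    fix w f assume w: "w \<in> carrier (sym_group n)" and f: "f \<in> {1..n} \<rightarrow>\<^sub>E J"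
    have "inv' w permutes {1..n}"
      using w by (simp add: sym_group_carrier permutes_inv)
    \<comment> \<open>\<open>inv' w\<close> fixes every point outside \<open>{1..n}\<close>, so the
      composite is still \<open>undefined\<close> there.\<close>
    from permutes_in_image[OF this] permutes_not_in[OF this] show "f \<circ> inv' w \<in> {1..n} \<rightarrow>\<^sub>E J"
      using f unfolding PiE_iff extensional_def by (simp del: atLeastAtMost_iff)
  next
    fix v w f assume "v \<in> carrier (sym_group n)" "w \<in> carrier (sym_group n)"
    then show "f \<circ> inv' (v \<otimes>\<^bsub>sym_group n\<^esub> w) = f \<circ> inv' w \<circ> inv' v"
      by (simp add: sym_group_carrier sym_group_mult o_inv_distrib permutes_bij comp_assoc)
  qed (simp add: sym_group_one)
qed

lemma fixed_function_iff:
  assumes "w permutes S"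
  shows "f \<circ> inv' w = f \<longleftrightarrow> f \<circ> w = f"
  using permutes_inv_o[OF assms] by (metis comp_assoc comp_id)

lemma sum_permuted_function:
  assumes "w permutes S"
  shows "(\<Sum>i\<in>S. g ((f \<circ> inv' w) i)) = (\<Sum>i\<in>S. g (f i))"
  using sum.permute[OF permutes_inv[OF assms], of "\<lambda>i. g (f i)"] by (simp add: o_def)

text \<open>The scalar enters as an additional factor without weight; later \<open>T\<close> is the
  fixed-point set counted by a permutation character.\<close>

lemma gen_series_scale:
  assumes g: "gen_series g J wt" and "finite T"
  shows "gen_series (scale_sf (of_nat (card T)) g) (T \<times> J) (\<lambda>p. wt (snd p))"
  unfolding gen_series_def
proof
  fix M
  have "{p \<in> T \<times> J. wt (snd p) = M} = T \<times> {j\<in>J. wt j = M}"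
    by auto
  then show "finite {p \<in> T \<times> J. wt (snd p) = M} \<and>
      coeff_sf (scale_sf (of_nat (card T)) g) M = of_nat (card {p \<in> T \<times> J. wt (snd p) = M})"
    using assms gen_series_finite[OF g] gen_series_coeff[OF g, of M]
    by (simp add: scale_sf.rep_eq card_cartesian_product)
qed

definition coloured_action ::
    "((nat \<Rightarrow> nat) \<Rightarrow> 'x \<Rightarrow> 'x) \<Rightarrow> (nat \<Rightarrow> nat) \<Rightarrow> 'x \<times> (nat \<Rightarrow> nat) \<Rightarrow> 'x \<times> (nat \<Rightarrow> nat)" where
  "coloured_action \<phi> w p = (\<phi> w (fst p), snd p \<circ> inv' w)"

lemma set_action_coloured:
  assumes "set_action (sym_group n) \<phi> X"
  shows "set_action (sym_group n) (coloured_action \<phi>) (X \<times> ({1..n} \<rightarrow>\<^sub>E UNIV))"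
proof -
  interpret A: set_action "sym_group n" \<phi> X
    by fact
  interpret B: set_action "sym_group n" "\<lambda>w f. f \<circ> inv' w" "{1..n} \<rightarrow>\<^sub>E UNIV"
    by (rule set_action_functions)
  show ?thesis
  proof
    show "coloured_action \<phi> w p \<in> X \<times> ({1..n} \<rightarrow>\<^sub>E UNIV)"
      if "w \<in> carrier (sym_group n)" "p \<in> X \<times> ({1..n} \<rightarrow>\<^sub>E UNIV)" for w p
      using that A.act_closed B.act_closed unfolding coloured_action_def mem_Times_iff fst_conv snd_conv by blast
  qed (auto simp: coloured_action_def A.act_one A.act_mult B.act_one B.act_mult)
qed

definition content :: "nat \<Rightarrow> (nat \<Rightarrow> nat) \<Rightarrow> nat multiset" where
  "content n c = (\<Sum>i\<in>{1..n}. {#c i#})"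

lemma perm_character_eq_card:
  assumes "finite X" "w \<in> carrier G"
  shows "perm_character G \<phi> X w = of_nat (card {t\<in>X. \<phi> w t = t})"
proof -
  have "(\<Sum>t\<in>X. perm_matrix \<phi> w t t) = of_nat (\<Sum>t\<in>X. of_bool (\<phi> w t = t))"
    by (simp add: perm_matrix_def eq_commute)
  also have "\<dots> = of_nat (card {t\<in>X. \<phi> w t = t})"
    using assms(1) by (simp add: sum.If_cases of_bool_def Int_def)
  finally show ?thesis
    using assms(2) by (simp add: perm_character_def)
qed

text \<open>The character value at \<open>w\<close> counts the points fixed by \<open>w\<close> and
  the power sum product counts the colourings fixed by \<open>w\<close>, so together they count the
  fixed pairs. The factor \<open>1 / fact n\<close> is the average in Burnside's lemma.\<close>

lemma gen_series_frobenius_perm_character: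
  assumes act: "set_action (sym_group n) \<phi> X" and "finite X"
  shows "gen_series (frobenius_ch n (perm_character (sym_group n) \<phi> X))
    (Group_Action.orbit (sym_group n) (coloured_action \<phi>) ` (X \<times> ({1..n} \<rightarrow>\<^sub>E UNIV)))
    (\<lambda>\<Omega>. content n (snd (SOME p. p \<in> \<Omega>)))"
proof -
  let ?G = "sym_group n"
  interpret set_action ?G "coloured_action \<phi>" "X \<times> ({1..n} \<rightarrow>\<^sub>E UNIV)"
    using act by (rule set_action_coloured)
  have gs: "gen_series (scale_sf (perm_character ?G \<phi> X w) (power_sum_part (cycle_type n w)))
      {p \<in> X \<times> ({1..n} \<rightarrow>\<^sub>E UNIV). coloured_action \<phi> w p = p} (\<lambda>p. content n (snd p))"
    if "w \<in> carrier ?G" for w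
  proof -
    have w: "w permutes {1..n}"
      using that by (simp add: sym_group_carrier)
    have "{p \<in> X \<times> ({1..n} \<rightarrow>\<^sub>E UNIV). coloured_action \<phi> w p = p} =
        {t\<in>X. \<phi> w t = t} \<times> {c \<in> {1..n} \<rightarrow>\<^sub>E UNIV. c \<circ> w = c}"
      by (auto simp: coloured_action_def fixed_function_iff[OF w])
    then show ?thesis
      using gen_series_scale[OF gen_series_power_sum_part_cycle_type[OF w], of "{t\<in>X. \<phi> w t = t}"]
        assms(2) that unfolding content_def by (simp add: perm_character_eq_card)
  qed
  have inv: "content n (snd (coloured_action \<phi> w p)) = content n (snd p)" if "w \<in> carrier ?G" for w p
    using sum_permuted_function[of w "{1..n}" "\<lambda>i. {#i#}"] that
    by (simp add: content_def coloured_action_def sym_group_carrier)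
  show ?thesis
    using gen_series_orbits[OF finite_sym_group inv gs] by (simp add: frobenius_ch_def card_sym_group)
qed

text \<open>The trivial character has the average of the
  \<open>power_sum_part (cycle_type r w)\<close> as characteristic (the complete symmetric function
  of degree \<open>r\<close>), so its plethysm with \<open>g\<close> averages the products of
  \<open>adams m g\<close>. The summand at \<open>w\<close> counts the functions into
  \<open>J\<close> fixed by \<open>w\<close>, and Burnside turns the average into orbits, which
  amount to multisets of \<open>r\<close> elements of \<open>J\<close>.\<close>

lemma gen_series_plethysm_trivial:
  assumes g: "gen_series g J wt"
  shows "gen_series (plethysm (frobenius_ch r (trivial_character (sym_group r))) g)
    (Group_Action.orbit (sym_group r) (\<lambda>w f. f \<circ> inv' w) ` ({1..r} \<rightarrow>\<^sub>E J))
    (\<lambda>\<Omega>. \<Sum>i\<in>{1..r}. wt ((SOME f. f \<in> \<Omega>) i))"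
proof -
  let ?G = "sym_group r"
  interpret set_action ?G "\<lambda>w f. f \<circ> inv' w" "{1..r} \<rightarrow>\<^sub>E J"
    by (rule set_action_functions)
  have "frobenius_ch r (trivial_character ?G) =
      (\<Sum>w\<in>carrier ?G. scale_sf (1 / fact r) (power_sum_part (cycle_type r w)))"
    unfolding frobenius_ch_def scale_sf_sum
    by (intro sum.cong) (auto simp: scale_sf_scale_sf trivial_character_def)
  then have eq: "plethysm (frobenius_ch r (trivial_character ?G)) g =
      scale_sf (1 / of_nat (card (carrier ?G))) (\<Sum>w\<in>carrier ?G. \<Prod>m\<in>#cycle_type r w. adams m g)"
    using plethysm_sum[OF finite_sym_group[of r], of "cycle_type r" "\<lambda>_. 1 / fact r" g]
      zero_notin_cycle_type by (simp add: scale_sf_sum card_sym_group sym_group_carrier)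
  have gs: "gen_series (\<Prod>m\<in>#cycle_type r w. adams m g)
      {f \<in> {1..r} \<rightarrow>\<^sub>E J. f \<circ> inv' w = f} (\<lambda>f. \<Sum>i\<in>{1..r}. wt (f i))" if "w \<in> carrier ?G" for w
    using gen_series_cycle_type[OF g, of w r] that
    by (simp add: sym_group_carrier fixed_function_iff[of w "{1..r}"] del: One_nat_def)
  have inv: "(\<Sum>i\<in>{1..r}. wt ((f \<circ> inv' w) i)) = (\<Sum>i\<in>{1..r}. wt (f i))"
    if "w \<in> carrier ?G" for w f
    using that by (intro sum_permuted_function) (simp add: sym_group_carrier)
  show ?thesis
    unfolding eq using finite_sym_group inv gs by (rule gen_series_orbits)
qed

text \<open>The map \<open>\<phi> u\<close> carries the fixed points of \<open>w\<close> bijectively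
  onto those of the conjugate of \<open>w\<close> by \<open>u\<close>.\<close>

lemma perm_character_class_function:
  assumes "set_action G \<phi> X" "finite X"
  shows "perm_character G \<phi> X \<in> class_functions G"
proof -
  interpret set_action G \<phi> X
    by fact
  have "card {t\<in>X. \<phi> (u \<otimes>\<^bsub>G\<^esub> w \<otimes>\<^bsub>G\<^esub> inv\<^bsub>G\<^esub> u) t = t} = card {t\<in>X. \<phi> w t = t}"
    if uw: "u \<in> carrier G" "w \<in> carrier G" for u w
  proof -
    have iff: "\<phi> (u \<otimes>\<^bsub>G\<^esub> w \<otimes>\<^bsub>G\<^esub> inv\<^bsub>G\<^esub> u) (\<phi> u t) = \<phi> u t \<longleftrightarrow> \<phi> w t = t" if "t \<in> X" for t
      using uw that bij_betw_act[OF uw(1)] act_closed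
      by (auto simp: act_mult act_inv bij_betw_def inj_on_def)
    have "bij_betw (\<phi> u) {t\<in>X. \<phi> w t = t} {t\<in>X. \<phi> (u \<otimes>\<^bsub>G\<^esub> w \<otimes>\<^bsub>G\<^esub> inv\<^bsub>G\<^esub> u) t = t}"
      using bij_betw_act[OF uw(1)] iff unfolding bij_betw_def inj_on_def by fastforce
    then show ?thesis
      by (simp add: bij_betw_same_card)
  qed
  then show ?thesis
    using assms(2) unfolding class_functions_def
    by (simp add: perm_character_eq_card) (simp add: perm_character_def)
qed

declare One_nat_def [simp del]

section \<open>Rooted forests and their automorphisms\<close>

lemma relabel_relabel: "relabel f (relabel g F) = relabel (f \<circ> g) F"
  by (simp add: relabel_def image_comp o_def)

lemma relabel_id: "relabel id (F :: 'v graph_with_roots) = F"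
  by (simp add: relabel_def)

lemma relabel_sel [simp]:
  "verts (relabel f F) = f ` verts F"
  "edges (relabel f F) = (\<lambda>e. f ` e) ` edges F"
  "roots (relabel f F) = f ` roots F"
  by (simp_all add: relabel_def)

text \<open>This is the part of being a rooted forest that makes \<open>relabel f F\<close> depend
  only on the values of \<open>f\<close> on \<open>verts F\<close>.\<close>

definition graph_wf :: "'v graph_with_roots \<Rightarrow> bool" where
  "graph_wf F \<longleftrightarrow> edges F \<subseteq> Pow (verts F) \<and> roots F \<subseteq> verts F"

lemma rooted_forest_wf: "rooted_forest F \<Longrightarrow> graph_wf F"
  by (auto simp: rooted_forest_def graph_wf_def)

lemma relabel_cong:
  assumes "graph_wf F" "\<And>v. v \<in> verts F \<Longrightarrow> f v = g v"
  shows "relabel f F = relabel g F"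
proof -
  have image: "f ` A = g ` A" if "A \<subseteq> verts F" for A
    using assms(2) that by (intro image_cong) auto
  have "f ` e = g ` e" if "e \<in> edges F" for e
    using assms(1) that by (intro image) (auto simp: graph_wf_def)
  then have "(\<lambda>e. f ` e) ` edges F = (\<lambda>e. g ` e) ` edges F"
    by (rule image_cong[OF refl])
  moreover have "f ` verts F = g ` verts F" "f ` roots F = g ` roots F"
    using assms(1) by (auto simp only: graph_wf_def intro!: image)
  ultimately show ?thesis
    by (simp add: relabel_def)
qed

lemma relabel_eq_self:
  assumes "graph_wf F" "\<And>v. v \<in> verts F \<Longrightarrow> f v = v"
  shows "relabel f F = F"
  using relabel_cong[of F f id] assms by (simp add: relabel_id)

lemma relabel_inv_into:
  assumes "graph_wf F" "inj_on f (verts F)"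
  shows "relabel (inv_into (verts F) f) (relabel f F) = F"
  unfolding relabel_relabel using assms by (intro relabel_eq_self) auto

lemma graph_eqI:
  fixes F F' :: "'v graph_with_roots"
  shows "verts F = verts F' \<Longrightarrow> edges F = edges F' \<Longrightarrow> roots F = roots F' \<Longrightarrow> F = F'"
  by simp

section \<open>Connected components\<close>

lemma component_of_self: "v \<in> verts F \<Longrightarrow> v \<in> component_of F v"
  by (simp add: component_of_def)

lemma component_of_eq:
  assumes "u \<in> component_of F v"
  shows "component_of F u = component_of F v"
proof -
  let ?E = "\<lambda>a b. {a, b} \<in> edges F"
  have "symp ?E"
    by (auto intro!: sympI simp: insert_commute)
  then have "?E\<^sup>*\<^sup>* u v" and "?E\<^sup>*\<^sup>* v u"
    using assms by (auto simp: component_of_def dest: sympD[OF symp_rtranclp])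
  then show ?thesis
    unfolding component_of_def by (auto intro: rtranclp_trans)
qed

lemma components_disjoint:
  "C \<in> components F \<Longrightarrow> D \<in> components F \<Longrightarrow> v \<in> C \<Longrightarrow> v \<in> D \<Longrightarrow> C = D"
  unfolding components_def by (elim imageE) (metis component_of_eq)

lemma edge_in_component:
  assumes "rooted_forest F" "e \<in> edges F"
  shows "\<exists>C\<in>components F. e \<subseteq> C"
proof -
  obtain u v where uv: "e = {u, v}" "u \<in> verts F" "v \<in> verts F"
    using assms by (auto simp: rooted_forest_def)
  then have "e \<subseteq> component_of F u"
    using assms(2) by (auto simp: component_of_def)
  then show ?thesis
    using uv by (auto simp: components_def)
qed

lemma rooted_tree_connected:
  assumes "rooted_tree T" "x \<in> verts T" "y \<in> verts T"
  shows "(\<lambda>a b. {a, b} \<in> edges T)\<^sup>*\<^sup>* x y"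
proof -
  have "component_of T x = component_of T y"
    using assms unfolding rooted_tree_def components_def by (metis imageI)
  then show ?thesis
    using component_of_self[OF assms(3)] by (auto simp: component_of_def)
qed

section \<open>Disjoint copies of a tree and their automorphisms\<close>

definition copies :: "nat \<Rightarrow> 'v graph_with_roots \<Rightarrow> (nat \<times> 'v) graph_with_roots" where
  "copies r T = \<lparr>verts = {1..r} \<times> verts T, edges = (\<Union>i\<in>{1..r}. (\<lambda>e. Pair i ` e) ` edges T),
     roots = {1..r} \<times> roots T\<rparr>"

lemma copies_sel [simp]:
  "verts (copies r T) = {1..r} \<times> verts T"
  "edges (copies r T) = (\<Union>i\<in>{1..r}. (\<lambda>e. Pair i ` e) ` edges T)"
  "roots (copies r T) = {1..r} \<times> roots T"
  by (simp_all add: copies_def)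

lemma copies_wf: "graph_wf T \<Longrightarrow> graph_wf (copies r T)"
  by (fastforce simp: graph_wf_def)

text \<open>In the model \<open>copies r T\<close> the first coordinate names the copy. Number the
  components by \<open>e\<close> and map \<open>T\<close> onto each. Distinct components are
  disjoint, so the glued map is injective; every edge of \<open>F\<close> lies inside one component,
  so none is missed.\<close>

lemma consists_of_copies_imp_isomorphic:
  assumes F: "rooted_forest F" "finite (verts F)" and "consists_of_copies F r T"
  shows "\<exists>\<Phi>. inj_on \<Phi> (verts (copies r T)) \<and> relabel \<Phi> (copies r T) = F"
proof -
  have "finite (components F)"
    using F(2) by (simp add: components_def)
  moreover have "card (components F) = r"
    using assms(3) by (simp add: consists_of_copies_def)
  ultimately obtain e where e: "bij_betw e {1..r} (components F)"
    using ex_bij_betw_nat_finite_1 by blast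
  \<comment> \<open>The given isomorphisms run from the components to \<open>T\<close>, so they are
    inverted.\<close>
  have "\<forall>C\<in>components F. \<exists>\<phi>. inj_on \<phi> (verts T) \<and> relabel \<phi> T = restrict_to F C"
  proof
    fix C assume "C \<in> components F"
    then obtain f where f: "inj_on f (verts (restrict_to F C))" "relabel f (restrict_to F C) = T"
      using assms(3) by (auto simp: consists_of_copies_def isomorphic_rooted_def)
    have wf: "graph_wf (restrict_to F C)"
      by (auto simp: graph_wf_def restrict_to_def)
    have "inj_on (inv_into (verts (restrict_to F C)) f) (verts T)"
      using f(2) by (auto intro: inj_on_inv_into)
    then show "\<exists>\<phi>. inj_on \<phi> (verts T) \<and> relabel \<phi> T = restrict_to F C"
      using relabel_inv_into[OF wf f(1)] f(2) by auto
  qed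
  then obtain \<phi> where \<phi>: "\<And>C. C \<in> components F \<Longrightarrow> inj_on (\<phi> C) (verts T)"
      "\<And>C. C \<in> components F \<Longrightarrow> relabel (\<phi> C) T = restrict_to F C"
    by metis
  have ec: "e i \<in> components F" if "i \<in> {1..r}" for i
    using e that by (rule bij_betwE[rule_format])
  have \<phi>_sel: "\<phi> C ` verts T = C" "(\<lambda>e. \<phi> C ` e) ` edges T = {e \<in> edges F. e \<subseteq> C}"
      "\<phi> C ` roots T = roots F \<inter> C" if "C \<in> components F" for C
    using arg_cong[OF \<phi>(2)[OF that], of verts] arg_cong[OF \<phi>(2)[OF that], of edges]
      arg_cong[OF \<phi>(2)[OF that], of roots] by (simp_all add: restrict_to_def)
  define \<Phi> where "\<Phi> = (\<lambda>(i, x). \<phi> (e i) x)"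
  have over: "(\<Union>i\<in>{1..r}. P (e i)) = (\<Union>C\<in>components F. P C)" for P :: "_ \<Rightarrow> 'c set"
    using bij_betw_imp_surj_on[OF e] by (metis image_image)
  have union: "\<Phi> ` ({1..r} \<times> A) = (\<Union>C\<in>components F. \<phi> C ` A)" for A
    unfolding over[symmetric] by (force simp: \<Phi>_def)
  have cover: "(\<Union>C\<in>components F. C) = verts F"
    by (auto simp: components_def component_of_self) (auto simp: component_of_def)
  have "inj_on \<Phi> ({1..r} \<times> verts T)"
  proof (rule inj_onI, clarify)
    fix i x j y assume ix: "i \<in> {1..r}" "x \<in> verts T" and jy: "j \<in> {1..r}" "y \<in> verts T"
      and eq: "\<Phi> (i, x) = \<Phi> (j, y)"
    have "\<Phi> (i, x) \<in> e i" "\<Phi> (j, y) \<in> e j"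
      using \<phi>_sel(1)[OF ec[OF ix(1)]] \<phi>_sel(1)[OF ec[OF jy(1)]] ix jy by (auto simp: \<Phi>_def)
    then have "e i = e j"
      using components_disjoint[OF ec[OF ix(1)] ec[OF jy(1)]] eq by simp
    then have "i = j"
      using inj_onD[OF bij_betw_imp_inj_on[OF e]] ix(1) jy(1) by blast
    then show "i = j \<and> x = y"
      using eq \<phi>(1)[OF ec[OF ix(1)]] ix jy by (auto simp: \<Phi>_def inj_on_def)
  qed
  moreover have "relabel \<Phi> (copies r T) = F"
  proof (rule graph_eqI)
    show "verts (relabel \<Phi> (copies r T)) = verts F"
      using \<phi>_sel(1) cover by (simp add: union)
    have "roots F \<subseteq> verts F"
      using F(1) by (simp add: rooted_forest_def)
    then show "roots (relabel \<Phi> (copies r T)) = roots F"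
      using \<phi>_sel(3) cover by (auto simp: union)
    have "edges (relabel \<Phi> (copies r T)) = (\<Union>i\<in>{1..r}. (\<lambda>d. \<phi> (e i) ` d) ` edges T)"
      by (simp add: image_UN image_image \<Phi>_def)
    also have "\<dots> = (\<Union>C\<in>components F. (\<lambda>d. \<phi> C ` d) ` edges T)"
      by (rule over)
    also have "\<dots> = (\<Union>C\<in>components F. {d \<in> edges F. d \<subseteq> C})"
      using \<phi>_sel(2) by simp
    also have "\<dots> = edges F"
      using edge_in_component[OF F(1)] by auto
    finally show "edges (relabel \<Phi> (copies r T)) = edges F" .
  qed
  ultimately show ?thesis
    by auto
qed

text \<open>Each \<open>a i\<close> preserves \<open>T\<close>, so only the index of the copy
  changes, and \<pi> merely reindexes the unions over \<open>{1..r}\<close>. For a finite rooted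
  tree, this and the next lemma describe the automorphisms of \<open>copies r T\<close> as a wreath
  product.\<close>

lemma relabel_copies_blockwise:
  assumes "\<pi> permutes {1..r}" "\<And>i. i \<in> {1..r} \<Longrightarrow> relabel (a i) T = T"
  shows "relabel (\<lambda>(i, x). (\<pi> i, a i x)) (copies r T) = copies r T"
proof -
  let ?\<alpha> = "\<lambda>(i, x). (\<pi> i, a i x)"
  have a: "a i ` verts T = verts T" "(\<lambda>e. a i ` e) ` edges T = edges T" "a i ` roots T = roots T"
    if "i \<in> {1..r}" for i
    using arg_cong[OF assms(2)[OF that], of verts] arg_cong[OF assms(2)[OF that], of edges]
      arg_cong[OF assms(2)[OF that], of roots] by simp_all
  have over: "(\<Union>i\<in>{1..r}. P (\<pi> i)) = (\<Union>i\<in>{1..r}. P i)" for P :: "_ \<Rightarrow> 'c set"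
    using permutes_image[OF assms(1)] by (metis image_image)
  have block: "?\<alpha> ` ({1..r} \<times> A) = {1..r} \<times> A" if "\<And>i. i \<in> {1..r} \<Longrightarrow> a i ` A = A" for A
  proof -
    have "?\<alpha> ` ({1..r} \<times> A) = (\<Union>i\<in>{1..r}. Pair (\<pi> i) ` (a i ` A))"
      by force
    also have "\<dots> = (\<Union>i\<in>{1..r}. Pair (\<pi> i) ` A)"
      using that by simp
    also have "\<dots> = (\<Union>i\<in>{1..r}. Pair i ` A)"
      by (rule over)
    finally show ?thesis
      by auto
  qed
  have "(\<lambda>e. ?\<alpha> ` e) ` (\<Union>i\<in>{1..r}. (\<lambda>e. Pair i ` e) ` edges T) =
      (\<Union>i\<in>{1..r}. (\<lambda>e. Pair (\<pi> i) ` e) ` ((\<lambda>e. a i ` e) ` edges T))"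
    by (simp add: image_UN image_image)
  also have "\<dots> = (\<Union>i\<in>{1..r}. (\<lambda>e. Pair (\<pi> i) ` e) ` edges T)"
    using a(2) by simp
  also have "\<dots> = (\<Union>i\<in>{1..r}. (\<lambda>e. Pair i ` e) ` edges T)"
    by (rule over)
  finally show ?thesis
    using block a by (intro graph_eqI) simp_all
qed

text \<open>An edge lies within one copy and so does its image; as \<open>T\<close> is connected,
  the index of the copy receiving the image is therefore constant on each copy. This index defines
  \<pi>, and the second coordinate defines \<open>a i\<close>.\<close>

lemma automorphism_copies_blockwise:
  assumes T: "rooted_tree T" "finite (verts T)"
    and \<alpha>: "inj_on \<alpha> (verts (copies r T))" "relabel \<alpha> (copies r T) = copies r T"
  shows "\<exists>\<pi> a. \<pi> permutes {1..r} \<and>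
    (\<forall>i\<in>{1..r}. a i permutes verts T \<and> relabel (a i) T = T \<and> (\<forall>x\<in>verts T. \<alpha> (i, x) = (\<pi> i, a i x)))"
proof -
  let ?V = "verts T"
  have wf: "graph_wf T"
    using T(1) rooted_forest_wf by (auto simp: rooted_tree_def)
  obtain x0 where x0: "x0 \<in> ?V"
    using T(1) by (auto simp: rooted_tree_def components_def)
  have \<alpha>V: "\<alpha> ` ({1..r} \<times> ?V) = {1..r} \<times> ?V"
    and \<alpha>E: "(\<lambda>e. \<alpha> ` e) ` edges (copies r T) = edges (copies r T)"
    and \<alpha>R: "\<alpha> ` ({1..r} \<times> roots T) = {1..r} \<times> roots T"
    using arg_cong[OF \<alpha>(2), of verts] arg_cong[OF \<alpha>(2), of edges] arg_cong[OF \<alpha>(2), of roots]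
    by simp_all
  have edge: "\<exists>j. \<exists>d\<in>edges T. \<alpha> ` Pair i ` e = Pair j ` d" if "i \<in> {1..r}" "e \<in> edges T" for i e
  proof -
    have "Pair i ` e \<in> edges (copies r T)"
      using that unfolding copies_sel by blast
    then have "\<alpha> ` Pair i ` e \<in> edges (copies r T)"
      using \<alpha>E by blast
    then show ?thesis
      by auto
  qed
  have fst_eq: "fst (\<alpha> (i, x)) = fst (\<alpha> (i, y))" if i: "i \<in> {1..r}" and xy: "x \<in> ?V" "y \<in> ?V" for i x y
    using rooted_tree_connected[OF T(1) xy]
  proof (induction rule: rtranclp_induct)
    case base
    show ?case ..
  next
    case (step y z)
    obtain j d where "\<alpha> ` Pair i ` {y, z} = Pair j ` d"
      using edge[OF i step.hyps(2)] by blast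
    then have "{\<alpha> (i, y), \<alpha> (i, z)} = Pair j ` d"
      by simp
    then have "fst ` {\<alpha> (i, y), \<alpha> (i, z)} \<subseteq> {j}"
      by auto
    then show ?case
      using step.IH by simp
  qed
  \<comment> \<open>By \<open>fst_eq\<close> the choice of \<open>x0\<close> is immaterial; \<pi>
    and \<open>a i\<close> are extended by the identity so that \<open>permutes\<close>
    applies.\<close>
  define p where "p = (\<lambda>i. fst (\<alpha> (i, x0)))"
  define \<pi> where "\<pi> = (\<lambda>i. if i \<in> {1..r} then p i else i)"
  define a where "a = (\<lambda>i x. if x \<in> ?V then snd (\<alpha> (i, x)) else x)"
  have \<alpha>_eq: "\<alpha> (i, x) = (\<pi> i, a i x)" if "i \<in> {1..r}" "x \<in> ?V" for i x
    using fst_eq[OF that x0] that by (simp add: \<pi>_def p_def a_def prod_eq_iff)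
  have \<alpha>_in: "\<pi> i \<in> {1..r}" "a i x \<in> ?V" if "i \<in> {1..r}" "x \<in> ?V" for i x
  proof -
    have "\<alpha> (i, x) \<in> \<alpha> ` ({1..r} \<times> ?V)"
      using that by blast
    then show "\<pi> i \<in> {1..r}" "a i x \<in> ?V"
      unfolding \<alpha>V \<alpha>_eq[OF that] by simp_all
  qed
  have inj_a: "inj_on (a i) ?V" if i: "i \<in> {1..r}" for i
  proof (rule inj_onI)
    fix x y assume "x \<in> ?V" "y \<in> ?V" "a i x = a i y"
    then have "\<alpha> (i, x) = \<alpha> (i, y)" "(i, x) \<in> verts (copies r T)" "(i, y) \<in> verts (copies r T)"
      using \<alpha>_eq i by auto
    then show "x = y"
      using inj_onD[OF \<alpha>(1)] by blast
  qed
  have bij_a: "bij_betw (a i) ?V ?V" if "i \<in> {1..r}" for i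
    using endo_inj_surj[OF T(2) _ inj_a[OF that]] \<alpha>_in(2)[OF that] inj_a[OF that]
    by (auto simp: bij_betw_def)
  have a_perm: "a i permutes ?V" if "i \<in> {1..r}" for i
    using bij_a[OF that] by (rule bij_imp_permutes) (simp add: a_def)
  \<comment> \<open>If copies \<open>i\<close> and \<open>j\<close> went to the same copy,
    surjectivity of \<open>a i\<close> would give a vertex of copy \<open>i\<close> with the same
    image as \<open>(j, x0)\<close>.\<close>
  have "inj_on \<pi> {1..r}"
  proof (rule inj_onI)
    fix i j assume ij: "i \<in> {1..r}" "j \<in> {1..r}" "\<pi> i = \<pi> j"
    obtain x where x: "x \<in> ?V" "a i x = a j x0"
      using bij_a[OF ij(1)] \<alpha>_in(2)[OF ij(2) x0] by (metis bij_betw_imp_surj_on imageE)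
    then have "\<alpha> (i, x) = \<alpha> (j, x0)" "(i, x) \<in> verts (copies r T)" "(j, x0) \<in> verts (copies r T)"
      using \<alpha>_eq ij x0 by auto
    then show "i = j"
      using inj_onD[OF \<alpha>(1)] by blast
  qed
  then have "bij_betw \<pi> {1..r} {1..r}"
    using endo_inj_surj[of "{1..r}" \<pi>] \<alpha>_in(1)[OF _ x0] by (simp add: bij_betw_def image_subset_iff)
  then have "\<pi> permutes {1..r}"
    by (rule bij_imp_permutes) (auto simp: \<pi>_def)
  moreover have "relabel (a i) T = T" if i: "i \<in> {1..r}" for i
  proof (rule graph_eqI)
    show "verts (relabel (a i) T) = verts T"
      using bij_a[OF i] by (simp add: bij_betw_def)
    have img: "a i ` d = snd ` \<alpha> ` Pair i ` d" if "d \<subseteq> ?V" for d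
      using that by (force simp: a_def image_image)
    \<comment> \<open>One inclusion suffices, here and for the roots: an injective map of a finite
      set into itself is onto.\<close>
    have "(\<lambda>e. a i ` e) ` edges T \<subseteq> edges T"
    proof clarify
      fix e assume e: "e \<in> edges T"
      then obtain j d where "d \<in> edges T" "\<alpha> ` Pair i ` e = Pair j ` d"
        using edge[OF i] by blast
      moreover have "e \<subseteq> ?V"
        using e wf by (auto simp: graph_wf_def)
      ultimately show "a i ` e \<in> edges T"
        using img[of e] by (simp add: image_image)
    qed
    moreover have "inj_on (\<lambda>e. a i ` e) (edges T)"
      using inj_on_image_Pow[OF inj_a[OF i]] wf by (auto simp: graph_wf_def intro: inj_on_subset)
    moreover have "finite (edges T)"
      using wf T(2) by (auto simp: graph_wf_def intro: finite_subset)
    ultimately show "edges (relabel (a i) T) = edges T"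
      by (simp add: endo_inj_surj)
    have sub: "roots T \<subseteq> ?V"
      using wf by (simp add: graph_wf_def)
    have "a i ` roots T \<subseteq> roots T"
    proof clarify
      fix x assume "x \<in> roots T"
      then have "\<alpha> (i, x) \<in> {1..r} \<times> roots T" "x \<in> ?V"
        using i \<alpha>R sub by blast+
      then show "a i x \<in> roots T"
        using \<alpha>_eq[OF i] by simp
    qed
    moreover have "inj_on (a i) (roots T)" "finite (roots T)"
      using inj_a[OF i] sub T(2) by (auto intro: inj_on_subset finite_subset)
    ultimately show "roots (relabel (a i) T) = roots T"
      by (simp add: endo_inj_surj)
  qed
  ultimately show ?thesis
    using a_perm \<alpha>_eq by blast
qed

section \<open>Coloured forests\<close>

abbreviation orbit_of :: "nat \<Rightarrow> nat graph_with_roots \<Rightarrow> nat graph_with_roots set" where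
  "orbit_of n F \<equiv> Group_Action.orbit (sym_group n) relabel F"

abbreviation colourings :: "nat \<Rightarrow> (nat \<Rightarrow> nat) set" where
  "colourings n \<equiv> {1..n} \<rightarrow>\<^sub>E UNIV"

lemma orbit_of_iff: "t \<in> orbit_of n F \<longleftrightarrow> (\<exists>w. w permutes {1..n} \<and> t = relabel w F)"
  by (auto simp: Group_Action.orbit_def sym_group_carrier)

lemma set_action_relabel: "set_action (sym_group n) relabel (orbit_of n F)"
proof -
  interpret group "sym_group n"
    by (rule sym_group_is_group)
  show ?thesis
  proof
    fix w t assume "w \<in> carrier (sym_group n)" "t \<in> orbit_of n F"
    then show "relabel w t \<in> orbit_of n F"
      unfolding orbit_of_iff sym_group_carrier by (metis permutes_compose relabel_relabel)
  qed (simp_all add: sym_group_one sym_group_mult relabel_id relabel_relabel)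
qed

lemma finite_orbit_of: "finite (orbit_of n F)"
proof -
  have "orbit_of n F = (\<lambda>w. relabel w F) ` carrier (sym_group n)"
    by (auto simp: Group_Action.orbit_def)
  then show ?thesis
    by (simp add: finite_sym_group)
qed

lemma self_in_orbit_of: "F \<in> orbit_of n F"
  unfolding orbit_of_iff by (metis permutes_id relabel_id)

lemma orbit_character_class_function: "orbit_character n F \<in> class_functions (sym_group n)"
  unfolding orbit_character_def
  using set_action_relabel finite_orbit_of by (rule perm_character_class_function)

abbreviation coloured_class :: "nat \<Rightarrow> nat graph_with_roots \<times> (nat \<Rightarrow> nat) \<Rightarrow>
    (nat graph_with_roots \<times> (nat \<Rightarrow> nat)) set" where
  "coloured_class n \<equiv> Group_Action.orbit (sym_group n) (coloured_action relabel)"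

text \<open>The permutation taking \<open>T\<close> to \<open>t\<close> is undone, at the price of
  changing the colouring. Thus a class can be recorded as a colouring of the fixed labelled tree
  \<open>T\<close>.\<close>

lemma coloured_class_representative:
  assumes "\<Omega> \<in> coloured_class k ` (orbit_of k T \<times> colourings k)"
  shows "\<exists>d \<in> colourings k. \<Omega> = coloured_class k (T, d)"
proof -
  interpret set_action "sym_group k" "coloured_action relabel" "orbit_of k T \<times> colourings k"
    using set_action_relabel by (rule set_action_coloured)
  obtain t d where td: "t \<in> orbit_of k T" "d \<in> colourings k" "\<Omega> = coloured_class k (t, d)"
    using assms by blast
  obtain u where u: "u permutes {1..k}" "t = relabel u T"
    using td(1) orbit_of_iff by blast
  have iu: "inv' u \<in> carrier (sym_group k)"
    using u(1) by (simp add: sym_group_carrier permutes_inv)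
  have "relabel (inv' u) t = T"
    using u by (simp add: relabel_relabel permutes_inv_o relabel_id)
  then have "coloured_action relabel (inv' u) (t, d) = (T, d \<circ> inv' (inv' u))"
    by (simp add: coloured_action_def)
  then have "coloured_class k (T, d \<circ> inv' (inv' u)) = \<Omega>"
      "(T, d \<circ> inv' (inv' u)) \<in> orbit_of k T \<times> colourings k"
    using orb_act[OF iu, of "(t, d)"] act_closed[OF iu, of "(t, d)"] td by (metis SigmaI)+
  then show ?thesis
    by blast
qed

text \<open>A coloured forest in the orbit of \<open>F\<close> is described, up to the order of its components, by the
  isomorphism classes of its coloured components.\<close>

definition component_classes ::
    "nat \<Rightarrow> nat \<Rightarrow> nat graph_with_roots \<Rightarrow> nat graph_with_roots \<times> (nat \<Rightarrow> nat) \<Rightarrow>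
      (nat \<Rightarrow> (nat graph_with_roots \<times> (nat \<Rightarrow> nat)) set) \<Rightarrow> bool" where
  "component_classes r k T p f \<longleftrightarrow>
     (\<exists>\<Phi>. inj_on \<Phi> ({1..r} \<times> {1..k}) \<and> relabel \<Phi> (copies r T) = fst p \<and>
        (\<forall>i\<in>{1..r}. f i = coloured_class k (T, \<lambda>x\<in>{1..k}. snd p (\<Phi> (i, x)))))"

section \<open>Coloured forests and the classes of their components\<close>

context
  fixes F T :: "nat graph_with_roots" and n k r :: nat
  assumes F: "rooted_forest F" "verts F = {1..n}"
    and T: "rooted_tree T" "verts T = {1..k}"
    and copies: "consists_of_copies F r T"
begin

interpretation K: set_action "sym_group k" "coloured_action relabel" "orbit_of k T \<times> colourings k"
  using set_action_relabel by (rule set_action_coloured)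

lemma wf: "graph_wf (copies r T)"
  using T(1) by (intro copies_wf rooted_forest_wf) (simp add: rooted_tree_def)

lemma verts_copies: "verts (copies r T) = {1..r} \<times> {1..k}"
  using T(2) by simp

text \<open>An isomorphism from the model onto \<open>F\<close> is followed by the permutation
  taking \<open>F\<close> to \<open>t\<close>. Such a chart \<Phi> numbers the components and gives
  each the vertices of \<open>T\<close> as coordinates; in general it is not unique.\<close>

lemma ex_chart:
  assumes "t \<in> orbit_of n F"
  shows "\<exists>\<Phi>. inj_on \<Phi> ({1..r} \<times> {1..k}) \<and> relabel \<Phi> (copies r T) = t"
proof -
  obtain \<Phi> where \<Phi>: "inj_on \<Phi> ({1..r} \<times> {1..k})" "relabel \<Phi> (copies r T) = F"
    using consists_of_copies_imp_isomorphic[OF F(1) _ copies] F(2) T(2) by auto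
  obtain w where w: "w permutes {1..n}" "t = relabel w F"
    using assms orbit_of_iff by blast
  have "inj_on (w \<circ> \<Phi>) ({1..r} \<times> {1..k})"
    using \<Phi>(1) permutes_inj[OF w(1)] by (intro comp_inj_on) (auto intro: inj_on_subset)
  then show ?thesis
    using w(2) \<Phi>(2) relabel_relabel by metis
qed

lemma chart_image:
  assumes "t \<in> orbit_of n F" "relabel \<Phi> (copies r T) = t"
  shows "\<Phi> ` ({1..r} \<times> {1..k}) = {1..n}"
proof -
  obtain w where w: "w permutes {1..n}" "t = relabel w F"
    using assms orbit_of_iff by blast
  have "\<Phi> ` ({1..r} \<times> {1..k}) = verts t"
    using assms(2) verts_copies by auto
  also have "\<dots> = {1..n}"
    using w F(2) permutes_image by (metis relabel_sel(1))
  finally show ?thesis .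
qed

lemma size_eq: "n = r * k"
proof -
  obtain \<Phi> where "inj_on \<Phi> ({1..r} \<times> {1..k})" "relabel \<Phi> (copies r T) = F"
    using ex_chart[OF self_in_orbit_of] by blast
  then have "bij_betw \<Phi> ({1..r} \<times> {1..k}) {1..n}"
    using chart_image[OF self_in_orbit_of] by (simp add: bij_betw_def)
  then show ?thesis
    using bij_betw_same_card by fastforce
qed

lemma component_classes_total:
  assumes "p \<in> orbit_of n F \<times> colourings n"
  shows "\<exists>f \<in> {1..r} \<rightarrow>\<^sub>E coloured_class k ` (orbit_of k T \<times> colourings k). component_classes r k T p f"
proof -
  obtain \<Phi> where \<Phi>: "inj_on \<Phi> ({1..r} \<times> {1..k})" "relabel \<Phi> (copies r T) = fst p"
    using ex_chart[of "fst p"] assms by auto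
  let ?d = "\<lambda>i. \<lambda>x\<in>{1..k}. snd p (\<Phi> (i, x))"
  let ?f = "\<lambda>i\<in>{1..r}. coloured_class k (T, ?d i)"
  have "(T, ?d i) \<in> orbit_of k T \<times> colourings k" for i
    using self_in_orbit_of by auto
  then have "?f \<in> {1..r} \<rightarrow>\<^sub>E coloured_class k ` (orbit_of k T \<times> colourings k)"
    by (intro restrict_PiE_iff[THEN iffD2] ballI imageI)
  moreover have "component_classes r k T p ?f"
    unfolding component_classes_def using \<Phi> by (intro exI[of _ \<Phi>]) simp
  ultimately show ?thesis
    by blast
qed

lemma component_classes_surj:
  assumes f: "f \<in> {1..r} \<rightarrow>\<^sub>E coloured_class k ` (orbit_of k T \<times> colourings k)"
  shows "\<exists>p \<in> orbit_of n F \<times> colourings n. component_classes r k T p f"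
proof -
  have "\<forall>i\<in>{1..r}. \<exists>d \<in> colourings k. f i = coloured_class k (T, d)"
    using f coloured_class_representative by (auto simp only: PiE_iff)
  then obtain d where d: "\<And>i. i \<in> {1..r} \<Longrightarrow> d i \<in> colourings k"
      "\<And>i. i \<in> {1..r} \<Longrightarrow> f i = coloured_class k (T, d i)"
    by metis
  obtain \<Phi> where \<Phi>: "inj_on \<Phi> ({1..r} \<times> {1..k})" "relabel \<Phi> (copies r T) = F"
    using ex_chart[OF self_in_orbit_of] by blast
  \<comment> \<open>The colouring transports \<open>d i\<close> along the chart to the
    \<open>i\<close>-th component of \<open>F\<close> itself.\<close>
  define c where "c = (\<lambda>v\<in>{1..n}. (case inv_into ({1..r} \<times> {1..k}) \<Phi> v of (i, x) \<Rightarrow> d i x))"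
  have c: "c (\<Phi> (i, x)) = d i x" if "i \<in> {1..r}" "x \<in> {1..k}" for i x
  proof -
    have "(i, x) \<in> {1..r} \<times> {1..k}"
      using that by simp
    moreover from this have "\<Phi> (i, x) \<in> {1..n}"
      using chart_image[OF self_in_orbit_of \<Phi>(2)] by blast
    ultimately show ?thesis
      unfolding c_def using inv_into_f_f[OF \<Phi>(1), of "(i, x)"] by simp
  qed
  have "(\<lambda>x\<in>{1..k}. c (\<Phi> (i, x))) = d i" if "i \<in> {1..r}" for i
    using d(1)[OF that] c[OF that] by (intro extensionalityI[of _ "{1..k}"]) (auto simp: PiE_iff)
  then have "component_classes r k T (F, c) f"
    unfolding component_classes_def using \<Phi> d(2) by (intro exI[of _ \<Phi>]) simp
  moreover have "(F, c) \<in> orbit_of n F \<times> colourings n"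
    using self_in_orbit_of by (auto simp: c_def)
  ultimately show ?thesis
    by blast
qed

text \<open>Forward, \<open>g\<close> read in the two charts is an automorphism of
  \<open>copies r T\<close>, so it acts blockwise, and its \<pi> matches the classes. Backward,
  equal classes yield automorphisms of \<open>T\<close> that carry one colouring to the other; they
  are assembled along \<pi> into a permutation of \<open>{1..n}\<close>.\<close>

lemma component_classes_compat:
  assumes p: "p \<in> orbit_of n F \<times> colourings n" and p': "p' \<in> orbit_of n F \<times> colourings n"
    and f: "f \<in> {1..r} \<rightarrow>\<^sub>E coloured_class k ` (orbit_of k T \<times> colourings k)"
    and f': "f' \<in> {1..r} \<rightarrow>\<^sub>E coloured_class k ` (orbit_of k T \<times> colourings k)"
    and R: "component_classes r k T p f" and R': "component_classes r k T p' f'"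
  shows "(\<exists>g\<in>carrier (sym_group n). coloured_action relabel g p = p') \<longleftrightarrow>
    (\<exists>\<pi>\<in>carrier (sym_group r). f \<circ> inv' \<pi> = f')"
proof -
  let ?U = "{1..r} \<times> {1..k}"
  obtain t c where tc: "p = (t, c)" "t \<in> orbit_of n F" "c \<in> colourings n"
    using p by auto
  obtain t' c' where tc': "p' = (t', c')" "t' \<in> orbit_of n F" "c' \<in> colourings n"
    using p' by auto
  obtain \<Phi> where \<Phi>: "inj_on \<Phi> ?U" "relabel \<Phi> (copies r T) = t"
      "\<And>i. i \<in> {1..r} \<Longrightarrow> f i = coloured_class k (T, \<lambda>x\<in>{1..k}. c (\<Phi> (i, x)))"
    using R by (auto simp: component_classes_def tc(1))
  obtain \<Phi>' where \<Phi>': "inj_on \<Phi>' ?U" "relabel \<Phi>' (copies r T) = t'"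
      "\<And>i. i \<in> {1..r} \<Longrightarrow> f' i = coloured_class k (T, \<lambda>x\<in>{1..k}. c' (\<Phi>' (i, x)))"
    using R' by (auto simp: component_classes_def tc'(1))
  note im = chart_image[OF tc(2) \<Phi>(2)] and im' = chart_image[OF tc'(2) \<Phi>'(2)]
  let ?d = "\<lambda>i. \<lambda>x\<in>{1..k}. c (\<Phi> (i, x))" and ?d' = "\<lambda>i. \<lambda>x\<in>{1..k}. c' (\<Phi>' (i, x))"
  have d_in: "(T, ?d i) \<in> orbit_of k T \<times> colourings k" "(T, ?d' i) \<in> orbit_of k T \<times> colourings k" for i
    using self_in_orbit_of by auto
  show ?thesis
  proof
    assume "\<exists>g\<in>carrier (sym_group n). coloured_action relabel g p = p'"
    then obtain g where g: "g permutes {1..n}" "relabel g t = t'" "c \<circ> inv' g = c'"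
      by (auto simp: coloured_action_def tc(1) tc'(1) sym_group_carrier)
    define \<alpha> where "\<alpha> = inv_into ?U \<Phi>' \<circ> (g \<circ> \<Phi>)"
    have g\<Phi>: "g (\<Phi> u) \<in> \<Phi>' ` ?U" if "u \<in> ?U" for u
      using that im permutes_in_image[OF g(1)] unfolding im' by blast
    have \<Phi>'\<alpha>: "\<Phi>' (\<alpha> u) = g (\<Phi> u)" if "u \<in> ?U" for u
      using f_inv_into_f[OF g\<Phi>[OF that]] by (simp add: \<alpha>_def)
    have "inj_on (g \<circ> \<Phi>) ?U"
      using \<Phi>(1) permutes_inj[OF g(1)] by (intro comp_inj_on) (auto intro: inj_on_subset)
    then have "inj_on (\<Phi>' \<circ> \<alpha>) ?U"
      using \<Phi>'\<alpha> by (simp cong: inj_on_cong)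
    then have inj: "inj_on \<alpha> (verts (copies r T))"
      unfolding verts_copies by (rule inj_on_imageI2)
    have "relabel \<alpha> (copies r T) = relabel (inv_into ?U \<Phi>') (relabel \<Phi>' (copies r T))"
      by (simp only: \<alpha>_def \<Phi>(2) \<Phi>'(2) g(2) flip: relabel_relabel)
    also have "\<dots> = copies r T"
      using relabel_inv_into[OF wf, of \<Phi>'] \<Phi>'(1) unfolding verts_copies by simp
    finally have "relabel \<alpha> (copies r T) = copies r T" .
    then obtain \<pi> a where \<pi>: "\<pi> permutes {1..r}" and a: "\<And>i. i \<in> {1..r} \<Longrightarrow> a i permutes {1..k}"
        "\<And>i. i \<in> {1..r} \<Longrightarrow> relabel (a i) T = T"
        "\<And>i x. i \<in> {1..r} \<Longrightarrow> x \<in> {1..k} \<Longrightarrow> \<alpha> (i, x) = (\<pi> i, a i x)"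
      using automorphism_copies_blockwise[OF T(1) _ inj] T(2) by (metis finite_atLeastAtMost)
    have "f' (\<pi> i) = f i" if i: "i \<in> {1..r}" for i
    proof -
      have "?d i x = ?d' (\<pi> i) (a i x)" for x
      proof (cases "x \<in> {1..k}")
        case True
        then have "c' (\<Phi>' (\<pi> i, a i x)) = c (inv' g (g (\<Phi> (i, x))))"
          using \<Phi>'\<alpha>[of "(i, x)"] a(3)[OF i] i g(3) by auto
        also have "\<dots> = c (\<Phi> (i, x))"
          using permutes_inverses(2)[OF g(1)] by simp
        finally show ?thesis
          using True permutes_in_image[OF a(1)[OF i]] by simp
      next
        case False
        then show ?thesis
          using permutes_in_image[OF a(1)[OF i]] by auto
      qed
      then have "?d i = ?d' (\<pi> i) \<circ> a i"
        by (simp only: fun_eq_iff o_apply) simp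
      then have "?d i \<circ> inv' (a i) = ?d' (\<pi> i)"
        using permutes_inv_o(1)[OF a(1)[OF i]] by (simp add: comp_assoc)
      then have "coloured_action relabel (a i) (T, ?d i) = (T, ?d' (\<pi> i))"
        using a(2)[OF i] by (simp add: coloured_action_def)
      then have "coloured_class k (T, ?d i) = coloured_class k (T, ?d' (\<pi> i))"
        using K.orb_act[of "a i" "(T, ?d i)"] a(1)[OF i] d_in by (simp add: sym_group_carrier)
      moreover have "\<pi> i \<in> {1..r}"
        using i permutes_in_image[OF \<pi>] by blast
      ultimately show ?thesis
        using \<Phi>(3)[OF i] \<Phi>'(3) by simp
    qed
    \<comment> \<open>Outside \<open>{1..r}\<close> both functions are \<open>undefined\<close> and
      \<pi> is the identity.\<close>
    moreover have "f' (\<pi> i) = f i" if "i \<notin> {1..r}" for i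
      using that f f' permutes_not_in[OF \<pi> that] by (auto simp: PiE_iff extensional_def)
    ultimately have "f' \<circ> \<pi> = f"
      by (auto simp: fun_eq_iff)
    then have "f \<circ> inv' \<pi> = f'"
      using permutes_inv_o(1)[OF \<pi>] by (auto simp: comp_assoc)
    then show "\<exists>\<pi>\<in>carrier (sym_group r). f \<circ> inv' \<pi> = f'"
      using \<pi> by (auto simp: sym_group_carrier)
  next
    assume "\<exists>\<pi>\<in>carrier (sym_group r). f \<circ> inv' \<pi> = f'"
    then obtain \<pi> where \<pi>: "\<pi> permutes {1..r}" "f \<circ> inv' \<pi> = f'"
      by (auto simp: sym_group_carrier)
    have \<pi>_in: "\<pi> i \<in> {1..r}" if "i \<in> {1..r}" for i
      using that permutes_in_image[OF \<pi>(1)] by blast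
    \<comment> \<open>Both classes are represented over the same tree \<open>T\<close>, so an
      \<open>a\<close> taking one representative to the other is an automorphism of
      \<open>T\<close>.\<close>
    have "\<forall>i\<in>{1..r}. \<exists>a. a permutes {1..k} \<and> coloured_action relabel a (T, ?d i) = (T, ?d' (\<pi> i))"
    proof
      fix i assume i: "i \<in> {1..r}"
      have "f' (\<pi> i) = f i"
        using permutes_inverses(2)[OF \<pi>(1)] by (simp flip: \<pi>(2))
      then have "coloured_class k (T, ?d i) = coloured_class k (T, ?d' (\<pi> i))"
        using \<Phi>(3)[OF i] \<Phi>'(3)[OF \<pi>_in[OF i]] by simp
      then show "\<exists>a. a permutes {1..k} \<and> coloured_action relabel a (T, ?d i) = (T, ?d' (\<pi> i))"
        using K.orb_eq_iff[OF d_in] by (auto simp only: sym_group_carrier)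
    qed
    then obtain a where a: "\<And>i. i \<in> {1..r} \<Longrightarrow> a i permutes {1..k}"
        "\<And>i. i \<in> {1..r} \<Longrightarrow> relabel (a i) T = T"
        "\<And>i. i \<in> {1..r} \<Longrightarrow> ?d i \<circ> inv' (a i) = ?d' (\<pi> i)"
      unfolding coloured_action_def fst_conv snd_conv prod.inject by metis
    let ?\<alpha> = "\<lambda>(i, x). (\<pi> i, a i x)"
    \<comment> \<open>This is the blockwise map, read from the chart \<Phi> into the chart
      \<open>\<Phi>'\<close> and extended by the identity.\<close>
    define g where "g = (\<lambda>v. if v \<in> {1..n} then \<Phi>' (?\<alpha> (inv_into ?U \<Phi> v)) else v)"
    have \<alpha>_in: "?\<alpha> u \<in> ?U" if "u \<in> ?U" for u
      using that \<pi>_in a(1) permutes_in_image by fastforce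
    have g\<Phi>: "g (\<Phi> u) = \<Phi>' (?\<alpha> u)" if "u \<in> ?U" for u
    proof -
      have "\<Phi> u \<in> {1..n}"
        using im that by blast
      then show ?thesis
        using inv_into_f_f[OF \<Phi>(1) that] by (simp add: g_def)
    qed
    have "inj_on ?\<alpha> ?U"
    proof (rule inj_onI, clarify)
      fix i x j y assume "i \<in> {1..r}" "j \<in> {1..r}" "\<pi> i = \<pi> j" "a i x = a j y"
      then show "i = j \<and> x = y"
        using permutes_inj[OF \<pi>(1)] permutes_inj[OF a(1)] by (metis injD)
    qed
    then have "inj_on (\<Phi>' \<circ> ?\<alpha>) ?U"
      using \<Phi>'(1) \<alpha>_in by (intro comp_inj_on) (auto intro: inj_on_subset)
    then have "inj_on (g \<circ> \<Phi>) ?U"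
      using g\<Phi> by (simp cong: inj_on_cong)
    then have inj_g: "inj_on g {1..n}"
      using im inj_on_imageI by metis
    have "g v \<in> {1..n}" if "v \<in> {1..n}" for v
    proof -
      have "v \<in> \<Phi> ` ?U"
        using that unfolding im .
      then obtain u where u: "u \<in> ?U" "v = \<Phi> u"
        by (rule imageE)
      have "\<Phi>' (?\<alpha> u) \<in> \<Phi>' ` ?U"
        using \<alpha>_in[OF u(1)] by (rule imageI)
      then show ?thesis
        unfolding u(2) g\<Phi>[OF u(1)] im' .
    qed
    then have "g ` {1..n} \<subseteq> {1..n}"
      by blast
    then have "bij_betw g {1..n} {1..n}"
      using endo_inj_surj[OF _ _ inj_g] inj_g by (simp add: bij_betw_def)
    then have g: "g permutes {1..n}"
      by (rule bij_imp_permutes) (auto simp: g_def)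
    have "relabel g t = relabel (g \<circ> \<Phi>) (copies r T)"
      by (simp only: \<Phi>(2) flip: relabel_relabel)
    also have "\<dots> = relabel (\<Phi>' \<circ> ?\<alpha>) (copies r T)"
      using wf by (rule relabel_cong) (use g\<Phi> verts_copies in auto)
    also have "\<dots> = relabel \<Phi>' (copies r T)"
      using relabel_copies_blockwise[OF \<pi>(1) a(2)] by (simp only: flip: relabel_relabel)
    finally have "relabel g t = t'"
      using \<Phi>'(2) by simp
    moreover have "c' (g v) = c v" for v
    proof (cases "v \<in> {1..n}")
      case True
      then obtain i x where ix: "i \<in> {1..r}" "x \<in> {1..k}" "v = \<Phi> (i, x)"
        using im by blast
      have ax: "a i x \<in> {1..k}"
        using ix permutes_in_image[OF a(1)] by blast
      have "c' (g v) = c' (\<Phi>' (\<pi> i, a i x))"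
        using g\<Phi>[of "(i, x)"] ix by simp
      also have "\<dots> = ?d' (\<pi> i) (a i x)"
        using ax by simp
      also have "\<dots> = ?d i (inv' (a i) (a i x))"
        unfolding a(3)[OF ix(1), symmetric] by simp
      also have "\<dots> = c v"
        using permutes_inverses(2)[OF a(1)[OF ix(1)]] ix by simp
      finally show ?thesis .
    next
      case False
      then show ?thesis
        using tc(3) tc'(3) by (auto simp: g_def PiE_iff extensional_def)
    qed
    then have "c \<circ> inv' g = c'"
      using permutes_inverses(1)[OF g] by (metis comp_apply ext)
    ultimately have "coloured_action relabel g p = p'"
      by (simp add: coloured_action_def tc(1) tc'(1))
    then show "\<exists>g\<in>carrier (sym_group n). coloured_action relabel g p = p'"
      using g by (auto simp: sym_group_carrier)
  qed
qed

lemma content_coloured_action: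
  assumes "w permutes {1..m}"
  shows "content m (snd (coloured_action \<phi> w p)) = content m (snd p)"
  using sum_permuted_function[OF assms, of "\<lambda>i. {#i#}"] by (simp add: content_def coloured_action_def)

text \<open>Summing along a chart splits the content by components. The action preserves content, so
  each share can be read off any representative of its class.\<close>

lemma component_classes_content:
  assumes p: "p \<in> orbit_of n F \<times> colourings n" and R: "component_classes r k T p f"
  shows "content n (snd p) = (\<Sum>i\<in>{1..r}. content k (snd (SOME q. q \<in> f i)))"
proof -
  obtain \<Phi> where \<Phi>: "inj_on \<Phi> ({1..r} \<times> {1..k})" "relabel \<Phi> (copies r T) = fst p"
      "\<And>i. i \<in> {1..r} \<Longrightarrow> f i = coloured_class k (T, \<lambda>x\<in>{1..k}. snd p (\<Phi> (i, x)))"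
    using R by (auto simp: component_classes_def)
  have "fst p \<in> orbit_of n F"
    using p by auto
  from chart_image[OF this \<Phi>(2)] have "bij_betw \<Phi> ({1..r} \<times> {1..k}) {1..n}"
    using \<Phi>(1) by (simp add: bij_betw_def)
  from sum.reindex_bij_betw[OF this, of "\<lambda>v. {#snd p v#}"]
  have "content n (snd p) = (\<Sum>u\<in>{1..r} \<times> {1..k}. {#snd p (\<Phi> u)#})"
    by (simp add: content_def)
  also have "\<dots> = (\<Sum>i\<in>{1..r}. \<Sum>x\<in>{1..k}. {#snd p (\<Phi> (i, x))#})"
    by (simp add: sum.cartesian_product)
  also have "\<dots> = (\<Sum>i\<in>{1..r}. content k (snd (SOME q. q \<in> f i)))"
  proof (rule sum.cong[OF refl])
    fix i assume i: "i \<in> {1..r}"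
    let ?q = "(T, \<lambda>x\<in>{1..k}. snd p (\<Phi> (i, x)))"
    have "content k (snd (SOME q. q \<in> coloured_class k ?q)) = content k (snd ?q)"
      by (rule K.weight_some[where wt = "\<lambda>q. content k (snd q)"])
        (use self_in_orbit_of in \<open>auto simp: content_coloured_action sym_group_carrier\<close>)
    then show "(\<Sum>x\<in>{1..k}. {#snd p (\<Phi> (i, x))#}) = content k (snd (SOME q. q \<in> f i))"
      unfolding \<Phi>(3)[OF i] by (simp add: content_def)
  qed
  finally show ?thesis .
qed

text \<open>Both sides are generating series of orbit sets, and \<open>component_classes\<close>
  matches these orbits with equal weights, so the coefficients agree.\<close>

lemma frobenius_ch_orbit_character:
  "frobenius_ch n (orbit_character n F) =
    plethysm (frobenius_ch r (trivial_character (sym_group r))) (frobenius_ch k (orbit_character k T))"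
proof -
  let ?J = "coloured_class k ` (orbit_of k T \<times> colourings k)"
  let ?wt = "\<lambda>\<Omega>. content k (snd (SOME p. p \<in> \<Omega>))"
  let ?X = "orbit_of n F \<times> colourings n" and ?Y = "{1..r} \<rightarrow>\<^sub>E ?J"
  let ?B = "Group_Action.orbit (sym_group r) (\<lambda>w f. f \<circ> inv' w)"
  have lhs: "gen_series (frobenius_ch n (orbit_character n F)) (coloured_class n ` ?X)
      (\<lambda>\<Omega>. content n (snd (SOME p. p \<in> \<Omega>)))"
    unfolding orbit_character_def
    using set_action_relabel finite_orbit_of by (rule gen_series_frobenius_perm_character)
  have "gen_series (frobenius_ch k (orbit_character k T)) ?J ?wt"
    unfolding orbit_character_def
    using set_action_relabel finite_orbit_of by (rule gen_series_frobenius_perm_character)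
  then have rhs: "gen_series (plethysm (frobenius_ch r (trivial_character (sym_group r)))
      (frobenius_ch k (orbit_character k T))) (?B ` ?Y)
      (\<lambda>\<Omega>. \<Sum>i\<in>{1..r}. ?wt ((SOME f. f \<in> \<Omega>) i))"
    by (rule gen_series_plethysm_trivial)
  have "\<exists>H. bij_betw H (coloured_class n ` ?X) (?B ` ?Y) \<and>
      (\<forall>\<Omega>\<in>coloured_class n ` ?X. content n (snd (SOME p. p \<in> \<Omega>)) =
        (\<Sum>i\<in>{1..r}. ?wt ((SOME f. f \<in> H \<Omega>) i)))"
  proof (rule orbit_bijection[where R = "component_classes r k T"
        and u = "\<lambda>p. content n (snd p)" and v = "\<lambda>f. \<Sum>i\<in>{1..r}. ?wt (f i)"])
    show "set_action (sym_group n) (coloured_action relabel) ?X"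
      using set_action_relabel by (rule set_action_coloured)
    show "set_action (sym_group r) (\<lambda>w f. f \<circ> inv' w) ?Y"
      by (rule set_action_functions)
    show "(\<Sum>i\<in>{1..r}. ?wt ((f \<circ> inv' w) i)) = (\<Sum>i\<in>{1..r}. ?wt (f i))"
      if "w \<in> carrier (sym_group r)" for w f
      using that by (intro sum_permuted_function) (simp add: sym_group_carrier)
    show "content n (snd p) = (\<Sum>i\<in>{1..r}. ?wt (f i))"
      if "p \<in> ?X" "component_classes r k T p f" for p f
      using that by (rule component_classes_content)
  qed (fact component_classes_total component_classes_surj component_classes_compat)+
  then obtain H where H: "bij_betw H (coloured_class n ` ?X) (?B ` ?Y)"
      "\<And>\<Omega>. \<Omega> \<in> coloured_class n ` ?X \<Longrightarrow> content n (snd (SOME p. p \<in> \<Omega>)) =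
        (\<Sum>i\<in>{1..r}. ?wt ((SOME f. f \<in> H \<Omega>) i))"
    by blast
  have "gen_series (plethysm (frobenius_ch r (trivial_character (sym_group r)))
      (frobenius_ch k (orbit_character k T))) (coloured_class n ` ?X)
      (\<lambda>\<Omega>. content n (snd (SOME p. p \<in> \<Omega>)))"
    using rhs H by (rule gen_series_bij)
  with lhs show ?thesis
    by (rule gen_series_unique)
qed

end

theorem theorem6p1:
  fixes \<sigma> \<tau> :: "nat graph_with_roots" and n k r :: nat
  assumes "rooted_forest \<sigma>" and "verts \<sigma> = {1..n}"
    and "rooted_tree \<tau>" and "verts \<tau> = {1..k}"
    and "consists_of_copies \<sigma> r \<tau>"
  shows "orbit_character n \<sigma> =
    char_plethysm r k (trivial_character (sym_group r)) (orbit_character k \<tau>)"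
proof -
  \<comment> \<open>The plethysm lies in the image of \<open>frobenius_ch n\<close>, being the
    characteristic of the orbit character, which is a class function; injectivity then leaves
    \<open>inv_into\<close> no other choice.\<close>
  have "char_plethysm r k (trivial_character (sym_group r)) (orbit_character k \<tau>) =
      inv_into (class_functions (sym_group n)) (frobenius_ch n) (frobenius_ch n (orbit_character n \<sigma>))"
    unfolding char_plethysm_def frobenius_ch_orbit_character[OF assms] size_eq[OF assms, symmetric] ..
  also have "\<dots> = orbit_character n \<sigma>"
    using inj_on_frobenius_ch orbit_character_class_function by (rule inv_into_f_f)
  finally show ?thesis ..
qed

end
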